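(* Let $(\mathcal{C},\tau)$ be a non-commutative probability space with a tracial weight $\omega$, let $\mathcal{A},\mathcal{B}\subset\mathcal{C}$ be $\ast$-subalgebras with $1_{\mathcal{C}}\in\mathcal{B}$ and $\mathcal{A}=M_\infty(\mathbb{C})$, with $\omega|_{\mathcal{A}}=\mathrm{Tr}$, and assume that $(\mathcal{A},\mathcal{B})$ is cyclically monotonically independent with respect to $(\tau,\omega)$. Let $a_1,\dots,a_p\in\mathcal{A}$ and $b_0,\dots,b_q\in\mathcal{B}$ be self-adjoint with $b_0=1$, $\tau(b_i)=0$ for $1\le i\le q$, and $\tau(b_ib_j)=\delta_{ij}$ for $0\le i,j\le q$. Let $$P=P(a_1,\dots,a_p,b_0,\dots,b_q)=\sum_{i_1,i_2=0}^{q}\sum_{j_1=1}^{p}\lambda_{i_1,i_2,j_1}\,b_{i_1}a_{j_1}b_{i_2}+R,$$ where $\lambda_{i_1,i_2,j_1}\in\mathbb{C}$ and $R$ is a linear combination of alternating monomials in the $a_i$ and the $b_j$, $j\neq0$, each containing at least two $a$'s. Let $n$ be large enough that $a_1,\dots,a_p\in M_n(\mathbb{C})$, and let $$\tilde P=\tilde P(a_1,\dots,a_p,\tilde b_{0,n},\dots,\tilde b_{q,n})=\sum_{i_1,i_2=0}^{q}\sum_{j_1=1}^{p}\lambda_{i_1,i_2,j_1}\,\tilde b_{i_1,n}\,\phi(a_{j_1})\,\tilde b_{i_2,n}\in M_n(\mathbb{C})\otimes M_{2^q}(\mathbb{C})$$ be its tensor model. Then for every integer $k\ge1$, $$\omega\big(P(a_1,\dots,a_p,b_0,\dots,b_q)^k\big)=\mathrm{Tr}_n\otimes\mathrm{Tr}_2^{\otimes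 q}\big(\tilde P(a_1,\dots,a_p,\tilde b_{0,n},\dots,\tilde b_{q,n})^k\big).$$
   Context: A tracial weight $\omega$ on a $\ast$-algebra $\mathcal{C}$ is a linear functional defined on a (possibly non-unital) $\ast$-subalgebra $\mathrm{D}(\omega)\subset\mathcal{C}$ with $\omega(a^*a)\ge0$, $\omega(a^* )=\overline{\omega(a)}$, $\omega(ab)=\omega(ba)$ for $a,b\in \mathrm{D}(\omega)$. A non-commutative probability space $(\mathcal{C},\tau)$ is a unital $\ast$-algebra over $\mathbb{C}$ with a tracial weight $\tau$ satisfying $\mathrm{D}(\tau)=\mathcal{C}$ and $\tau(1)=1$. For $\ast$-subalgebras $\mathcal{A},\mathcal{B}\subset\mathcal{C}$ with $1_{\mathcal{C}}\in\mathcal{B}$, $\mathrm{Ideal}_{\mathcal{B}}(\mathcal{A})=\mathrm{span}\{b_0a_1b_1\cdots a_nb_n: n\in\mathbb{N},\,a_i\in\mathcal{A},\,b_i\in\mathcal{B}\}$ (with $n\ge1$). The pair $(\mathcal{A},\mathcal{B})$ is cyclically monotonically independent with respect to $(\tau,\omega)$ if $\mathrm{Ideal}_{\mathcal{B}}(\mathcal{A})\subset \mathrm{D}(\omega)$ and for all $n\ge1$, $a_1,\dots,a_n\in\mathcal{A}$, $b_0,\dots,b_n\in\mathcal{B}$, $$\omega(b_0a_1b_1\cdots a_nb_n)=\omega(a_1\cdots a_n)\,\tau(b_1)\cdots\tau(b_{n-1})\,\tau(b_nb_0).$$ $M_\infty(\mathbb{C})$ is the inductive limit of the $M_n(\mathbb{C})$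 under the non-unital embeddings $M_n(\mathbb{C})\to M_m(\mathbb{C})$ ($n<m$), $a\mapsto\begin{pmatrix}a&0\\0&0\end{pmatrix}$, and $\mathrm{Tr}$ on $M_\infty(\mathbb{C})$ is the trace induced by the non-normalized traces $\mathrm{Tr}_n$ on $M_n(\mathbb{C})$. An alternating monomial is one in which factors $a_i$ and factors $b_j$ ($j\neq 0$) alternate; in particular any two consecutive $a$'s are separated by exactly one $b_j$ with $j\ne0$ (it may begin and end with either an $a$ or a $b$). Tensor model: let $I_n$ be the $n\times n$ identity matrix, $J=\begin{pmatrix}0&1\\1&0\end{pmatrix}$, $E_{11}=\begin{pmatrix}1&0\\0&0\end{pmatrix}$, and identify $M_{2^q}(\mathbb{C})=M_2(\mathbb{C})^{\otimes q}$. Put $B_0=I_{2^q}$ and, for $1\le i\le q$, $B_i=I_2\otimes\cdots\otimes J\otimes\cdots\otimes I_2$ ($q$ tensor factors, $J$ in position $i$). Then $\tilde b_{i,n}=I_n\otimes B_i$ for $0\le i\le q$, and $\phi(a)=a\otimes E_{11}^{\otimes q}$ for $a\in M_n(\mathbb{C})$. *)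

theory Defs
  imports "Jordan_Normal_Form.Schur_Decomposition"
begin

section \<open>Complex star-algebras\<close>

class star_algebra = ring +
  fixes scaleC :: "complex \<Rightarrow> 'a \<Rightarrow> 'a" (infixr "*\<^sub>C" 75)
    and star :: "'a \<Rightarrow> 'a"
  assumes scaleC_add_right: "c *\<^sub>C (x + y) = c *\<^sub>C x + c *\<^sub>C y"
    and scaleC_add_left: "(c + d) *\<^sub>C x = c *\<^sub>C x + d *\<^sub>C x"
    and scaleC_scaleC: "c *\<^sub>C d *\<^sub>C x = (c * d) *\<^sub>C x"
    and scaleC_one: "1 *\<^sub>C x = x"
    and mult_scaleC_left: "(c *\<^sub>C x) * y = c *\<^sub>C (x * y)"
    and mult_scaleC_right: "x * (c *\<^sub>C y) = c *\<^sub>C (x * y)"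
    and star_star: "star (star x) = x"
    and star_add: "star (x + y) = star x + star y"
    and star_scaleC: "star (c *\<^sub>C x) = cnj c *\<^sub>C star x"
    and star_mult: "star (x * y) = star y * star x"

class unital_star_algebra = star_algebra + ring_1

global_interpretation cvec: vector_space "scaleC :: complex \<Rightarrow> 'a \<Rightarrow> 'a::star_algebra"
  by unfold_locales
    (simp_all add: scaleC_add_right scaleC_add_left scaleC_scaleC scaleC_one)

definition star_subalgebra :: "'a::star_algebra set \<Rightarrow> bool" where
  "star_subalgebra S \<longleftrightarrow>
     cvec.subspace S \<and> (\<forall>x\<in>S. \<forall>y\<in>S. x * y \<in> S) \<and> (\<forall>x\<in>S. star x \<in> S)"

definition star_hom :: "('a::star_algebra \<Rightarrow> 'b::star_algebra) \<Rightarrow> bool" where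
  "star_hom f \<longleftrightarrow>
     (\<forall>x y. f (x + y) = f x + f y) \<and> (\<forall>c x. f (c *\<^sub>C x) = c *\<^sub>C f x) \<and>
     (\<forall>x y. f (x * y) = f x * f y) \<and> (\<forall>x. f (star x) = star (f x))"

text \<open>A weight is a functional on its domain \<open>D\<close>; it is represented by a total function
  whose values outside \<open>D\<close> are irrelevant.\<close>

definition tracial_weight :: "'a::star_algebra set \<Rightarrow> ('a \<Rightarrow> complex) \<Rightarrow> bool" where
  "tracial_weight D \<omega> \<longleftrightarrow>
     star_subalgebra D \<and>
     (\<forall>x\<in>D. \<forall>y\<in>D. \<omega> (x + y) = \<omega> x + \<omega> y) \<and>
     (\<forall>c. \<forall>x\<in>D. \<omega> (c *\<^sub>C x) = c * \<omega> x) \<and>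
     (\<forall>x\<in>D. \<omega> (star x * x) \<in> \<real> \<and> Re (\<omega> (star x * x)) \<ge> 0) \<and>
     (\<forall>x\<in>D. \<omega> (star x) = cnj (\<omega> x)) \<and>
     (\<forall>x\<in>D. \<forall>y\<in>D. \<omega> (x * y) = \<omega> (y * x))"

definition nc_probability_space :: "('a::unital_star_algebra \<Rightarrow> complex) \<Rightarrow> bool" where
  "nc_probability_space \<tau> \<longleftrightarrow> tracial_weight UNIV \<tau> \<and> \<tau> 1 = 1"


section \<open>Cyclic monotone independence\<close>

text \<open>The product \<open>b\<^sub>0 a\<^sub>1 b\<^sub>1 \<dots> a\<^sub>n b\<^sub>n\<close>.\<close>

definition alt_prod :: "nat \<Rightarrow> (nat \<Rightarrow> 'a::unital_star_algebra) \<Rightarrow> (nat \<Rightarrow> 'a) \<Rightarrow> 'a" where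
  "alt_prod n a b = b 0 * prod_list (map (\<lambda>i. a i * b i) [1..<Suc n])"

definition ideal_gen :: "'a::unital_star_algebra set \<Rightarrow> 'a set \<Rightarrow> 'a set" where
  "ideal_gen B A = cvec.span {alt_prod n a b | n a b.
     n \<ge> 1 \<and> (\<forall>i\<in>{1..n}. a i \<in> A) \<and> (\<forall>i\<in>{0..n}. b i \<in> B)}"

definition cyclic_monotone_indep ::
  "'a::unital_star_algebra set \<Rightarrow> 'a set \<Rightarrow> ('a \<Rightarrow> complex) \<Rightarrow> 'a set \<Rightarrow> ('a \<Rightarrow> complex) \<Rightarrow> bool"
where
  "cyclic_monotone_indep A B \<tau> D \<omega> \<longleftrightarrow>
     ideal_gen B A \<subseteq> D \<and>
     (\<forall>n\<ge>1. \<forall>a b. (\<forall>i\<in>{1..n}. a i \<in> A) \<and> (\<forall>i\<in>{0..n}. b i \<in> B) \<longrightarrow>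
        \<omega> (alt_prod n a b) =
          \<omega> (prod_list (map a [1..<Suc n])) * (\<Prod>i=1..n-1. \<tau> (b i)) * \<tau> (b n * b 0))"


section \<open>The inductive limit of the matrix algebras\<close>

definition square :: "complex mat \<Rightarrow> bool" where
  "square X \<longleftrightarrow> dim_row X = dim_col X"

definition corner_embed :: "nat \<Rightarrow> complex mat \<Rightarrow> complex mat" where
  "corner_embed m X = (let n = dim_row X in
     four_block_mat X (0\<^sub>m n (m - n)) (0\<^sub>m (m - n) n) (0\<^sub>m (m - n) (m - n)))"

definition mtrace :: "complex mat \<Rightarrow> complex" where
  "mtrace X = (\<Sum>i<dim_row X. X $$ (i, i))"

text \<open>The disjoint union of the $M_n$ is the set of all square matrices, since a matrix carries
  its dimensions. Two of them are equal in the limit if they become equal at some later stage.\<close>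

definition eventually_equal :: "complex mat \<Rightarrow> complex mat \<Rightarrow> bool" where
  "eventually_equal X Y \<longleftrightarrow> square X \<and> square Y \<and>
     (\<exists>m. dim_row X \<le> m \<and> dim_row Y \<le> m \<and> corner_embed m X = corner_embed m Y)"

definition entry :: "complex mat \<Rightarrow> nat \<Rightarrow> nat \<Rightarrow> complex" where
  "entry X i j = (if i < dim_row X \<and> j < dim_col X then X $$ (i, j) else 0)"

lemma corner_embed_carrier:
  assumes "square X" "dim_row X \<le> m"
  shows "corner_embed m X \<in> carrier_mat m m"
  using assms unfolding corner_embed_def Let_def square_def
  by (intro carrier_matI) simp_all

lemma entry_corner_embed:
  assumes "square X"
  shows "entry (corner_embed m X) = entry X"
  using assms unfolding corner_embed_def Let_def square_def entry_def
  by (intro ext) auto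

lemma entry_eqI:
  assumes "X \<in> carrier_mat m k" "Y \<in> carrier_mat m k" "entry X = entry Y"
  shows "X = Y"
proof (rule eq_matI)
  fix i j assume "i < dim_row Y" "j < dim_col Y"
  then show "X $$ (i, j) = Y $$ (i, j)"
    using fun_cong[OF fun_cong[OF assms(3), of i], of j] assms(1,2) by (simp add: entry_def)
qed (use assms in auto)

lemma eventually_equal_iff:
  "eventually_equal X Y \<longleftrightarrow> square X \<and> square Y \<and> entry X = entry Y"
proof
  assume *: "eventually_equal X Y"
  then have sq: "square X" "square Y"
    by (simp_all add: eventually_equal_def)
  from * obtain m where "corner_embed m X = corner_embed m Y"
    unfolding eventually_equal_def by blast
  then have "entry (corner_embed m X) = entry (corner_embed m Y)"
    by (rule arg_cong)
  then show "square X \<and> square Y \<and> entry X = entry Y"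
    unfolding entry_corner_embed[OF sq(1)] entry_corner_embed[OF sq(2)] using sq by blast
next
  assume "square X \<and> square Y \<and> entry X = entry Y"
  then have *: "square X" "square Y" "entry X = entry Y"
    by blast+
  let ?m = "max (dim_row X) (dim_row Y)"
  have "corner_embed ?m X = corner_embed ?m Y"
  proof (rule entry_eqI)
    show "corner_embed ?m X \<in> carrier_mat ?m ?m" "corner_embed ?m Y \<in> carrier_mat ?m ?m"
      using * by (simp_all add: corner_embed_carrier)
    show "entry (corner_embed ?m X) = entry (corner_embed ?m Y)"
      unfolding entry_corner_embed[OF *(1)] entry_corner_embed[OF *(2)] by (rule *(3))
  qed
  with *(1,2) show "eventually_equal X Y"
    unfolding eventually_equal_def by (intro conjI exI[of _ ?m]) simp_all
qed

quotient_type mat_inf = "complex mat" / partial: eventually_equal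
proof (rule part_equivpI)
  show "\<exists>x. eventually_equal x x"
    by (rule exI[of _ "0\<^sub>m 0 0"]) (simp add: eventually_equal_iff square_def)
  show "symp eventually_equal"
    by (auto simp: symp_def eventually_equal_iff)
  show "transp eventually_equal"
    by (auto simp: transp_def eventually_equal_iff)
qed

text \<open>For square \<open>X\<close> this is the class of \<open>X\<close>; restricted to \<open>carrier_mat n n\<close> it is
  the canonical map from $M_n$ into the limit. It is not meant to be used on other matrices.\<close>

definition of_mat :: "complex mat \<Rightarrow> mat_inf" where
  "of_mat X = abs_mat_inf X"

lemma entry_add:
  "X \<in> carrier_mat m m \<Longrightarrow> Y \<in> carrier_mat m m \<Longrightarrow>
    entry (X + Y) i j = entry X i j + entry Y i j"
  by (auto simp: entry_def)

lemma entry_minus: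
  "X \<in> carrier_mat m m \<Longrightarrow> Y \<in> carrier_mat m m \<Longrightarrow>
    entry (X - Y) i j = entry X i j - entry Y i j"
  by (auto simp: entry_def)

lemma entry_mult:
  assumes "X \<in> carrier_mat m m" "Y \<in> carrier_mat m m" "m \<le> N"
  shows "entry (X * Y) i j = (\<Sum>k<N. entry X i k * entry Y k j)"
proof (cases "i < m \<and> j < m")
  case True
  then have "entry (X * Y) i j = (\<Sum>k<m. entry X i k * entry Y k j)"
    using assms by (auto simp: entry_def scalar_prod_def lessThan_atLeast0 intro!: sum.cong)
  also have "\<dots> = (\<Sum>k<N. entry X i k * entry Y k j)"
    using assms by (intro sum.mono_neutral_left) (auto simp: entry_def)
  finally show ?thesis .
next
  case False
  then show ?thesis using assms by (auto simp: entry_def)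
qed

text \<open>The operations act at any stage at which both arguments live.\<close>

definition lift_stage ::
  "(complex mat \<Rightarrow> complex mat \<Rightarrow> complex mat) \<Rightarrow> complex mat \<Rightarrow> complex mat \<Rightarrow> complex mat" where
  "lift_stage f X Y =
     (let m = max (dim_row X) (dim_row Y) in f (corner_embed m X) (corner_embed m Y))"

lemma stage_carrier:
  assumes "square X" "square Y"
  shows "corner_embed (max (dim_row X) (dim_row Y)) X
      \<in> carrier_mat (max (dim_row X) (dim_row Y)) (max (dim_row X) (dim_row Y))"
    and "corner_embed (max (dim_row X) (dim_row Y)) Y
      \<in> carrier_mat (max (dim_row X) (dim_row Y)) (max (dim_row X) (dim_row Y))"
  using assms by (auto intro: corner_embed_carrier)

lemma eventually_equal_stage_add:
  assumes "eventually_equal X X'" "eventually_equal Y Y'"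
  shows "eventually_equal (lift_stage (+) X Y) (lift_stage (+) X' Y')"
proof -
  have *: "square X" "square X'" "square Y" "square Y'" "entry X = entry X'" "entry Y = entry Y'"
    using assms by (auto simp: eventually_equal_iff)
  note c = stage_carrier[OF *(1) *(3)] and c' = stage_carrier[OF *(2) *(4)]
  have "entry (lift_stage (+) X Y) i j = entry (lift_stage (+) X' Y') i j" for i j
    using entry_add[OF c, of i j] entry_add[OF c', of i j]
    by (simp only: lift_stage_def Let_def entry_corner_embed[OF *(1)] entry_corner_embed[OF *(2)]
        entry_corner_embed[OF *(3)] entry_corner_embed[OF *(4)] *(5,6))
  moreover have "square (lift_stage (+) X Y)" "square (lift_stage (+) X' Y')"
    unfolding lift_stage_def Let_def square_def using c c'
    by (simp_all only: index_add_mat(2,3) carrier_matD)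
  ultimately show ?thesis by (simp add: eventually_equal_iff fun_eq_iff)
qed

lemma eventually_equal_stage_minus:
  assumes "eventually_equal X X'" "eventually_equal Y Y'"
  shows "eventually_equal (lift_stage (-) X Y) (lift_stage (-) X' Y')"
proof -
  have *: "square X" "square X'" "square Y" "square Y'" "entry X = entry X'" "entry Y = entry Y'"
    using assms by (auto simp: eventually_equal_iff)
  note c = stage_carrier[OF *(1) *(3)] and c' = stage_carrier[OF *(2) *(4)]
  have "entry (lift_stage (-) X Y) i j = entry (lift_stage (-) X' Y') i j" for i j
    using entry_minus[OF c, of i j] entry_minus[OF c', of i j]
    by (simp only: lift_stage_def Let_def entry_corner_embed[OF *(1)] entry_corner_embed[OF *(2)]
        entry_corner_embed[OF *(3)] entry_corner_embed[OF *(4)] *(5,6))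
  moreover have "square (lift_stage (-) X Y)" "square (lift_stage (-) X' Y')"
    unfolding lift_stage_def Let_def square_def using c c'
    by (simp_all only: index_minus_mat(2,3) carrier_matD)
  ultimately show ?thesis by (simp add: eventually_equal_iff fun_eq_iff)
qed

lemma eventually_equal_stage_mult:
  assumes "eventually_equal X X'" "eventually_equal Y Y'"
  shows "eventually_equal (lift_stage (*) X Y) (lift_stage (*) X' Y')"
proof -
  have *: "square X" "square X'" "square Y" "square Y'" "entry X = entry X'" "entry Y = entry Y'"
    using assms by (auto simp: eventually_equal_iff)
  note c = stage_carrier[OF *(1) *(3)] and c' = stage_carrier[OF *(2) *(4)]
  have "entry (lift_stage (*) X Y) i j = entry (lift_stage (*) X' Y') i j" for i j
    using entry_mult[OF c max.cobounded1, where b1 = "max (dim_row X') (dim_row Y')" and i = i and j = j]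
      entry_mult[OF c' max.cobounded2, where a1 = "max (dim_row X) (dim_row Y)" and i = i and j = j]
    by (simp only: lift_stage_def Let_def entry_corner_embed[OF *(1)] entry_corner_embed[OF *(2)]
        entry_corner_embed[OF *(3)] entry_corner_embed[OF *(4)] *(5,6))
  moreover have "square (lift_stage (*) X Y)" "square (lift_stage (*) X' Y')"
    unfolding lift_stage_def Let_def square_def using c c'
    by (simp_all only: index_mult_mat(2,3) carrier_matD)
  ultimately show ?thesis by (simp add: eventually_equal_iff fun_eq_iff)
qed

lemma mtrace_entry:
  assumes "square X" "dim_row X \<le> N"
  shows "mtrace X = (\<Sum>i<N. entry X i i)"
proof -
  have "mtrace X = (\<Sum>i<dim_row X. entry X i i)"
    using assms by (auto simp: mtrace_def entry_def square_def intro!: sum.cong)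
  also have "\<dots> = (\<Sum>i<N. entry X i i)"
    using assms by (intro sum.mono_neutral_left) (auto simp: entry_def)
  finally show ?thesis .
qed

lemma mat_adjoint_dim [simp]:
  "dim_row (mat_adjoint X) = dim_col X" "dim_col (mat_adjoint X) = dim_row X"
  by (auto simp: mat_adjoint_def)

lemma index_mat_adjoint:
  "i < dim_col X \<Longrightarrow> j < dim_row X \<Longrightarrow> mat_adjoint X $$ (i, j) = cnj (X $$ (j, i))"
  for X :: "complex mat"
  by (auto simp: mat_adjoint_def mat_of_rows_def)

lemma entry_adjoint: "entry (mat_adjoint X) = (\<lambda>i j. cnj (entry X j i))"
  by (intro ext) (auto simp: entry_def index_mat_adjoint)

lemma entry_smult: "entry (c \<cdot>\<^sub>m X) = (\<lambda>i j. c * entry X i j)"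
  by (intro ext) (auto simp: entry_def)

instantiation mat_inf :: star_algebra
begin

lift_definition zero_mat_inf :: mat_inf is "0\<^sub>m 0 0"
  by (simp add: eventually_equal_iff square_def)

lift_definition plus_mat_inf :: "mat_inf \<Rightarrow> mat_inf \<Rightarrow> mat_inf" is "lift_stage (+)"
  by (rule eventually_equal_stage_add)

lift_definition minus_mat_inf :: "mat_inf \<Rightarrow> mat_inf \<Rightarrow> mat_inf" is "lift_stage (-)"
  by (rule eventually_equal_stage_minus)

lift_definition uminus_mat_inf :: "mat_inf \<Rightarrow> mat_inf" is "\<lambda>X. (-1) \<cdot>\<^sub>m X"
  by (simp add: eventually_equal_iff square_def entry_smult)

lift_definition times_mat_inf :: "mat_inf \<Rightarrow> mat_inf \<Rightarrow> mat_inf" is "lift_stage (*)"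
  by (rule eventually_equal_stage_mult)

lift_definition scaleC_mat_inf :: "complex \<Rightarrow> mat_inf \<Rightarrow> mat_inf" is "\<lambda>c X. c \<cdot>\<^sub>m X"
  by (simp add: eventually_equal_iff square_def entry_smult)

lift_definition star_mat_inf :: "mat_inf \<Rightarrow> mat_inf" is mat_adjoint
  by (simp add: eventually_equal_iff square_def entry_adjoint)

lemma of_mat_eqI: "square X \<Longrightarrow> square Y \<Longrightarrow> entry X = entry Y \<Longrightarrow> of_mat X = of_mat Y"
  unfolding of_mat_def
  by (rule Quotient3_rel_abs[OF Quotient3_mat_inf]) (simp add: eventually_equal_iff)

lemma corner_embed_id: "X \<in> carrier_mat n n \<Longrightarrow> corner_embed n X = X"
  by (rule entry_eqI[of _ n n])
    (auto simp: entry_corner_embed square_def intro!: corner_embed_carrier)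

lemma of_mat_corner_embed: "square X \<Longrightarrow> dim_row X \<le> m \<Longrightarrow> of_mat (corner_embed m X) = of_mat X"
  using corner_embed_carrier[of X m]
  by (intro of_mat_eqI) (auto simp: entry_corner_embed square_def)

lemma of_mat_ops:
  assumes "X \<in> carrier_mat n n" "Y \<in> carrier_mat n n"
  shows "of_mat X + of_mat Y = of_mat (X + Y)"
    and "of_mat X - of_mat Y = of_mat (X - Y)"
    and "of_mat X * of_mat Y = of_mat (X * Y)"
  using assms
  by (simp_all add: of_mat_def plus_mat_inf.abs_eq minus_mat_inf.abs_eq times_mat_inf.abs_eq
      eventually_equal_iff square_def lift_stage_def corner_embed_id)

lemma of_mat_unary:
  assumes "X \<in> carrier_mat n n"
  shows "c *\<^sub>C of_mat X = of_mat (c \<cdot>\<^sub>m X)"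
    and "star (of_mat X) = of_mat (mat_adjoint X)"
    and "- of_mat X = of_mat ((-1) \<cdot>\<^sub>m X)"
  using assms
  by (simp_all add: of_mat_def scaleC_mat_inf.abs_eq star_mat_inf.abs_eq uminus_mat_inf.abs_eq
      eventually_equal_iff square_def)

lemma zero_of_mat: "0 = of_mat (0\<^sub>m n n)"
proof -
  have "0 = of_mat (0\<^sub>m 0 0)" by (simp add: of_mat_def zero_mat_inf_def)
  also have "\<dots> = of_mat (0\<^sub>m n n)"
    by (intro of_mat_eqI) (auto simp: square_def entry_def fun_eq_iff)
  finally show ?thesis .
qed

lemma mat_inf_rep: obtains X where "square X" "x = of_mat X"
  using mat_inf.abs_induct[of "\<lambda>x. \<exists>X. square X \<and> x = of_mat X" x]
  by (auto simp: of_mat_def eventually_equal_iff)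

lemma mat_inf_rep3:
  obtains n X Y Z where "X \<in> carrier_mat n n" "Y \<in> carrier_mat n n" "Z \<in> carrier_mat n n"
    "x = of_mat X" "y = of_mat Y" "z = of_mat Z"
proof -
  obtain X where X: "square X" "x = of_mat X" by (rule mat_inf_rep)
  obtain Y where Y: "square Y" "y = of_mat Y" by (rule mat_inf_rep)
  obtain Z where Z: "square Z" "z = of_mat Z" by (rule mat_inf_rep)
  let ?n = "dim_row X + dim_row Y + dim_row Z"
  show ?thesis
    by (rule that[of "corner_embed ?n X" ?n "corner_embed ?n Y" "corner_embed ?n Z"])
      (use X Y Z in \<open>auto simp: of_mat_corner_embed intro!: corner_embed_carrier\<close>)
qed

instance
proof
  fix x y z :: mat_inf and c d :: complex
  obtain n X Y Z where c: "X \<in> carrier_mat n n" "Y \<in> carrier_mat n n" "Z \<in> carrier_mat n n"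
    and e: "x = of_mat X" "y = of_mat Y" "z = of_mat Z"
    by (rule mat_inf_rep3)
  note ops = of_mat_ops[where n = n] of_mat_unary[where n = n] and z = zero_of_mat[of n]
  have adj: "mat_adjoint W \<in> carrier_mat n n" if "W \<in> carrier_mat n n" for W :: "complex mat"
    using that by auto
  show "x + y + z = x + (y + z)"
    using c by (simp add: e ops assoc_add_mat[of _ n n])
  show "x + y = y + x"
    using c by (simp add: e ops comm_add_mat[of _ n n])
  show "0 + x = x"
    using c by (simp add: e ops z)
  show "- x + x = 0"
    using c by (simp add: e ops z) (intro arg_cong[where f = of_mat] eq_matI, auto)
  show "x - y = x + - y"
    using c by (simp add: e ops) (intro arg_cong[where f = of_mat] eq_matI, auto)
  show "x * y * z = x * (y * z)"
    using c by (simp add: e ops assoc_mult_mat[of _ n n _ n _ n])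
  show "(x + y) * z = x * z + y * z"
    using c by (simp add: e ops add_mult_distrib_mat[of _ n n _ _ n])
  show "x * (y + z) = x * y + x * z"
    using c by (simp add: e ops mult_add_distrib_mat[of _ n n _ n])
  show "c *\<^sub>C (x + y) = c *\<^sub>C x + c *\<^sub>C y"
    using c by (simp add: e ops) (intro arg_cong[where f = of_mat] eq_matI, auto simp: algebra_simps)
  show "(c + d) *\<^sub>C x = c *\<^sub>C x + d *\<^sub>C x"
    using c by (simp add: e ops) (intro arg_cong[where f = of_mat] eq_matI, auto simp: algebra_simps)
  show "c *\<^sub>C d *\<^sub>C x = (c * d) *\<^sub>C x"
    using c by (simp add: e ops) (intro arg_cong[where f = of_mat] eq_matI, auto simp: algebra_simps)
  show "1 *\<^sub>C x = x"
    using c by (simp add: e ops) (intro arg_cong[where f = of_mat] eq_matI, auto)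
  show "(c *\<^sub>C x) * y = c *\<^sub>C (x * y)"
    using c by (simp add: e ops mult_smult_assoc_mat[of _ n n _ n])
  show "x * (c *\<^sub>C y) = c *\<^sub>C (x * y)"
    using c by (simp add: e ops mult_smult_distrib[of _ n n _ n])
  show "star (star x) = x"
    using c by (simp add: e ops adj)
      (intro arg_cong[where f = of_mat] eq_matI, auto simp: index_mat_adjoint)
  show "star (x + y) = star x + star y"
    using c by (simp add: e ops adj)
      (intro arg_cong[where f = of_mat] eq_matI, auto simp: index_mat_adjoint)
  show "star (c *\<^sub>C x) = cnj c *\<^sub>C star x"
    using c by (simp add: e ops adj)
      (intro arg_cong[where f = of_mat] eq_matI, auto simp: index_mat_adjoint)
  show "star (x * y) = star y * star x"
    using c by (simp add: e ops adj)
      (intro arg_cong[where f = of_mat] eq_matI,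
        auto simp: index_mat_adjoint scalar_prod_def mult.commute intro!: sum.cong)
qed

end

lift_definition Tr_inf :: "mat_inf \<Rightarrow> complex" is mtrace
proof -
  fix X Y assume "eventually_equal X Y"
  then show "mtrace X = mtrace Y"
    using mtrace_entry[of X "max (dim_row X) (dim_row Y)"]
      mtrace_entry[of Y "max (dim_row X) (dim_row Y)"]
    by (simp add: eventually_equal_iff)
qed

lemma Tr_inf_of_mat: "square X \<Longrightarrow> Tr_inf (of_mat X) = mtrace X"
  by (simp add: of_mat_def Tr_inf.abs_eq eventually_equal_iff)


section \<open>Alternating monomials\<close>

datatype letter = LetA nat | LetB nat

fun is_A :: "letter \<Rightarrow> bool" where
  "is_A (LetA _) \<longleftrightarrow> True"
| "is_A (LetB _) \<longleftrightarrow> False"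

definition alternating_monomial :: "nat \<Rightarrow> nat \<Rightarrow> letter list \<Rightarrow> bool" where
  "alternating_monomial p q w \<longleftrightarrow>
     set w \<subseteq> LetA ` {1..p} \<union> LetB ` {1..q} \<and> successively (\<lambda>x y. is_A x \<noteq> is_A y) w"

definition eval_monomial ::
  "(nat \<Rightarrow> 'a::unital_star_algebra) \<Rightarrow> (nat \<Rightarrow> 'a) \<Rightarrow> letter list \<Rightarrow> 'a" where
  "eval_monomial a b w = prod_list (map (\<lambda>x. case x of LetA i \<Rightarrow> a i | LetB j \<Rightarrow> b j) w)"


section \<open>The tensor model\<close>

text \<open>The identification of $M_n \otimes M_m$ with $M_{nm}$ sends the basis vector
  \<open>e\<^sub>i \<otimes> e\<^sub>k\<close> to \<open>e\<^bsub>i * m + k\<^esub>\<close>.\<close>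

definition kron :: "complex mat \<Rightarrow> complex mat \<Rightarrow> complex mat" (infixr "\<otimes>\<^sub>K" 72) where
  "X \<otimes>\<^sub>K Y = mat (dim_row X * dim_row Y) (dim_col X * dim_col Y)
     (\<lambda>(i, j). X $$ (i div dim_row Y, j div dim_col Y) * Y $$ (i mod dim_row Y, j mod dim_col Y))"

definition kron_list :: "complex mat list \<Rightarrow> complex mat" where
  "kron_list Xs = foldr kron Xs (1\<^sub>m 1)"

definition unit_mat :: "nat \<Rightarrow> nat \<Rightarrow> nat \<Rightarrow> complex mat" where
  "unit_mat n i j = mat n n (\<lambda>rs. if rs = (i, j) then 1 else 0)"

text \<open>The tensor product of linear functionals on $M_n$ and $M_m$, given on the basis
  \<open>E\<^sub>i\<^sub>j \<otimes> E\<^sub>k\<^sub>l\<close>.\<close>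

definition tensor_functional ::
  "nat \<Rightarrow> (complex mat \<Rightarrow> complex) \<Rightarrow> nat \<Rightarrow> (complex mat \<Rightarrow> complex) \<Rightarrow> complex mat \<Rightarrow> complex"
where
  "tensor_functional n \<phi> m \<psi> Z =
     (\<Sum>i<n. \<Sum>j<n. \<Sum>k<m. \<Sum>l<m.
        Z $$ (i * m + k, j * m + l) * (\<phi> (unit_mat n i j) * \<psi> (unit_mat m k l)))"

lemma tensor_functional_kron:
  assumes X: "X \<in> carrier_mat n n" and Y: "Y \<in> carrier_mat m m"
    and \<phi>: "\<phi> X = (\<Sum>i<n. \<Sum>j<n. X $$ (i, j) * \<phi> (unit_mat n i j))"
    and \<psi>: "\<psi> Y = (\<Sum>k<m. \<Sum>l<m. Y $$ (k, l) * \<psi> (unit_mat m k l))"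
  shows "tensor_functional n \<phi> m \<psi> (X \<otimes>\<^sub>K Y) = \<phi> X * \<psi> Y"
proof -
  have idx: "i * m + k < n * m" if "i < n" "k < m" for i k
  proof -
    have "i * m + k < Suc i * m" using that by simp
    also have "\<dots> \<le> n * m" using that by (intro mult_right_mono) auto
    finally show ?thesis .
  qed
  have "(X \<otimes>\<^sub>K Y) $$ (i * m + k, j * m + l) = X $$ (i, j) * Y $$ (k, l)"
    if "i < n" "j < n" "k < m" "l < m" for i j k l
    using that X Y by (simp add: kron_def idx)
  then have "tensor_functional n \<phi> m \<psi> (X \<otimes>\<^sub>K Y) = (\<Sum>i<n. \<Sum>j<n. \<Sum>k<m. \<Sum>l<m.
      (X $$ (i, j) * \<phi> (unit_mat n i j)) * (Y $$ (k, l) * \<psi> (unit_mat m k l)))"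
    unfolding tensor_functional_def by (intro sum.cong refl) (simp add: mult_ac)
  also have "\<dots> = \<phi> X * \<psi> Y"
    unfolding \<phi> \<psi> by (simp only: sum_distrib_right) (simp only: sum_distrib_left)
  finally show ?thesis .
qed

fun Tr2_power :: "nat \<Rightarrow> complex mat \<Rightarrow> complex" where
  "Tr2_power 0 Z = Z $$ (0, 0)"
| "Tr2_power (Suc q) Z = tensor_functional 2 mtrace (2 ^ q) (Tr2_power q) Z"

definition J_mat :: "complex mat" where
  "J_mat = mat_of_rows_list 2 [[0, 1], [1, 0]]"

definition E11_mat :: "complex mat" where
  "E11_mat = mat_of_rows_list 2 [[1, 0], [0, 0]]"

definition B_mat :: "nat \<Rightarrow> nat \<Rightarrow> complex mat" where
  "B_mat q i = (if i = 0 then 1\<^sub>m (2 ^ q)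
     else kron_list (map (\<lambda>k. if k = i then J_mat else 1\<^sub>m 2) [1..<Suc q]))"

definition b_tilde :: "nat \<Rightarrow> nat \<Rightarrow> nat \<Rightarrow> complex mat" where
  "b_tilde n q i = 1\<^sub>m n \<otimes>\<^sub>K B_mat q i"

definition phi_mat :: "nat \<Rightarrow> complex mat \<Rightarrow> complex mat" where
  "phi_mat q X = X \<otimes>\<^sub>K kron_list (replicate q E11_mat)"

definition mat_sum :: "nat \<Rightarrow> ('i \<Rightarrow> complex mat) \<Rightarrow> 'i set \<Rightarrow> complex mat" where
  "mat_sum N f I = mat N N (\<lambda>rs. \<Sum>i\<in>I. f i $$ rs)"

text \<open>The coefficients are indexed as in \<open>\<lambda> i\<^sub>1 i\<^sub>2 j\<close>, and \<open>X j\<close> is the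
  \<open>n \<times> n\<close> matrix that represents \<open>a\<^sub>j\<close>.\<close>

definition P_tilde ::
  "nat \<Rightarrow> nat \<Rightarrow> nat \<Rightarrow> (nat \<Rightarrow> nat \<Rightarrow> nat \<Rightarrow> complex) \<Rightarrow> (nat \<Rightarrow> complex mat) \<Rightarrow> complex mat" where
  "P_tilde n p q c X = mat_sum (n * 2 ^ q)
     (\<lambda>(i1, i2, j). c i1 i2 j \<cdot>\<^sub>m (b_tilde n q i1 * phi_mat q (X j) * b_tilde n q i2))
     ({0..q} \<times> {0..q} \<times> {1..p})"

end

theory Submission
  imports Defs
begin

text \<open>
  The weight \<open>\<omega>\<close> does not see all of the algebra generated by \<open>A\<close> and \<open>B\<close>: let \<open>N\<close> be the set
  of those \<open>x\<close> for which \<open>u x v\<close> lies in \<open>D\<close> and has weight \<open>0\<close> for all words \<open>u, v\<close> in \<open>A\<close> and \<open>B\<close>. It is a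
  subspace that absorbs products with that algebra on both sides (\<open>null_mult_span\<close>). In the moment formula of cyclic monotone
  independence an inner factor \<open>b\<close> enters only through \<open>\<tau> b\<close>, which says precisely that
  \<open>a b a' - \<tau>(b) a a'\<close> lies in \<open>N\<close> (\<open>null_cut\<close>). This has two consequences.

  An alternating monomial with at least two letters \<open>a\<close> contains a factor \<open>a b\<^sub>j a'\<close> with
  \<open>\<tau> b\<^sub>j = 0\<close>, so it lies in \<open>N\<close>; hence the remainder \<open>R\<close> can be dropped from \<open>P\<close>.

  The remaining linear part is \<open>\<Sum>\<^sub>s\<^sub>t b\<^sub>s \<alpha>\<^sub>s\<^sub>t b\<^sub>t\<close> with \<open>\<alpha>\<^sub>s\<^sub>t = \<Sum>\<^sub>j \<lambda>\<^sub>s\<^sub>t\<^sub>j a\<^sub>j\<close>. Because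
  \<open>\<tau> (b\<^sub>t b\<^sub>u) = \<delta>\<^sub>t\<^sub>u\<close>, such sums multiply modulo \<open>N\<close> as the block matrices \<open>(\<alpha>\<^sub>s\<^sub>t)\<close> do, so
  that \<open>P\<^sup>k\<close> agrees modulo \<open>N\<close> with \<open>\<Sum>\<^sub>s\<^sub>t b\<^sub>s (\<alpha>\<^sup>k)\<^sub>s\<^sub>t b\<^sub>t\<close> (\<open>power_mod_null\<close>), whose weight is
  the block trace \<open>\<Sum>\<^sub>s \<omega> ((\<alpha>\<^sup>k)\<^sub>s\<^sub>s)\<close> (\<open>weight_power\<close>).

  The tensor model follows the same multiplication rule. There
  \<open>B\<^sub>s E\<^sub>1\<^sub>1\<^sup>\<otimes>\<^sup>q B\<^sub>t\<close> is the first column of \<open>B\<^sub>s\<close> times the first row of \<open>B\<^sub>t\<close>, and the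
  pairing of the first row of \<open>B\<^sub>t\<close> with the first column of \<open>B\<^sub>u\<close> is the corner entry of
  \<open>B\<^sub>t B\<^sub>u\<close>, again \<open>\<delta>\<^sub>t\<^sub>u\<close> (\<open>B_mat_orthonormal\<close>). Hence the powers of the model are governed by
  the same block powers (\<open>P_tilde_power_blocks\<close>) and have the same trace
  (\<open>trace_P_tilde_power\<close>).
\<close>

section \<open>Words and the null ideal of a cyclically monotone pair\<close>

text \<open>The pair \<open>(a\<^sub>i, b\<^sub>i)\<close> is one list element because cutting and concatenating alternating products
  is then cutting and concatenating lists.\<close>

definition word :: "'a::unital_star_algebra \<Rightarrow> ('a \<times> 'a) list \<Rightarrow> 'a" where
  "word x l = x * prod_list (map (\<lambda>(a, b). a * b) l)"

lemma alt_prod_word: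
  "word x l = alt_prod (length l) (\<lambda>i. fst (l ! (i - 1))) (\<lambda>i. if i = 0 then x else snd (l ! (i - 1)))"
proof -
  have "map (\<lambda>(a, b). a * b) l
      = map (\<lambda>i. fst (l ! (i - 1)) * (if i = 0 then x else snd (l ! (i - 1)))) [1..<Suc (length l)]"
    by (rule nth_equalityI) (simp_all del: upt_Suc add: case_prod_beta)
  then show ?thesis by (simp add: word_def alt_prod_def)
qed

lemma prod_list_butlast_nth:
  fixes f :: "'a \<Rightarrow> 'b::comm_monoid_mult"
  assumes "l \<noteq> []"
  shows "(\<Prod>i=1..length l - 1. f (l ! (i - 1))) = prod_list (map f (butlast l))"
proof -
  have "(\<Prod>i=1..length l - 1. f (l ! (i - 1))) = (\<Prod>i<length l - 1. f (l ! i))"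
    by (rule prod.reindex_bij_witness[of _ Suc "\<lambda>i. i - 1"]) auto
  also have "\<dots> = (\<Prod>i<length (butlast l). f (butlast l ! i))"
    by (intro prod.cong) (auto simp: nth_butlast)
  also have "\<dots> = prod_list (map f (butlast l))"
    by (simp add: prod.list_conv_set_nth atLeast0LessThan)
  finally show ?thesis .
qed

locale cyclic_monotone_pair =
  fixes \<tau> \<omega> :: "'c::unital_star_algebra \<Rightarrow> complex" and D A B :: "'c set"
  assumes weight: "tracial_weight D \<omega>"
    and subalgebra_A: "star_subalgebra A" and subalgebra_B: "star_subalgebra B"
    and one_B: "1 \<in> B"
    and indep: "cyclic_monotone_indep A B \<tau> D \<omega>"
begin

lemma mult_A: "x \<in> A \<Longrightarrow> y \<in> A \<Longrightarrow> x * y \<in> A"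
  using subalgebra_A by (auto simp: star_subalgebra_def)

lemma mult_B: "x \<in> B \<Longrightarrow> y \<in> B \<Longrightarrow> x * y \<in> B"
  using subalgebra_B by (auto simp: star_subalgebra_def)

lemma subspace_A: "cvec.subspace A"
  using subalgebra_A by (auto simp: star_subalgebra_def)

lemma subspace_D: "cvec.subspace D"
  using weight by (auto simp: star_subalgebra_def tracial_weight_def)

lemma weight_add: "x \<in> D \<Longrightarrow> y \<in> D \<Longrightarrow> \<omega> (x + y) = \<omega> x + \<omega> y"
  and weight_scale: "x \<in> D \<Longrightarrow> \<omega> (c *\<^sub>C x) = c * \<omega> x"
  using weight by (auto simp: tracial_weight_def)

lemma weight_zero: "\<omega> 0 = 0"
  using weight_scale[OF cvec.subspace_0[OF subspace_D], of 0] by simp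

lemma weight_sum:
  assumes "\<And>i. i \<in> I \<Longrightarrow> f i \<in> D"
  shows "\<omega> (\<Sum>i\<in>I. f i) = (\<Sum>i\<in>I. \<omega> (f i))"
  using assms
  by (induction I rule: infinite_finite_induct)
    (auto simp: weight_zero weight_add cvec.subspace_sum[OF subspace_D])

lemma weight_word:
  assumes "x \<in> B" "set l \<subseteq> A \<times> B" "l \<noteq> []"
  shows "word x l \<in> D"
    and "\<omega> (word x l)
      = \<omega> (prod_list (map fst l)) * prod_list (map (\<lambda>y. \<tau> (snd y)) (butlast l)) * \<tau> (snd (last l) * x)"
proof -
  let ?n = "length l"
  let ?a = "\<lambda>i. fst (l ! (i - 1))" and ?b = "\<lambda>i. if i = 0 then x else snd (l ! (i - 1))"
  have mem: "l ! i \<in> A \<times> B" if "i < ?n" for i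
    using assms(2) nth_mem[OF that] by blast
  have n: "?n \<ge> 1" using assms(3) by (cases l) auto
  have a: "\<forall>i\<in>{1..?n}. ?a i \<in> A"
  proof
    fix i assume "i \<in> {1..?n}"
    then show "?a i \<in> A" using mem[of "i - 1"] by (cases "l ! (i - 1)") auto
  qed
  have b: "\<forall>i\<in>{0..?n}. ?b i \<in> B"
  proof
    fix i assume "i \<in> {0..?n}"
    then show "?b i \<in> B" using mem[of "i - 1"] assms(1) by (cases "l ! (i - 1)") auto
  qed
  have "alt_prod ?n ?a ?b \<in> ideal_gen B A"
    unfolding ideal_gen_def using n a b by (intro cvec.span_base) blast
  then show "word x l \<in> D"
    using indep by (auto simp: cyclic_monotone_indep_def alt_prod_word)
  have fsts: "map ?a [1..<Suc ?n] = map fst l"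
    by (rule nth_equalityI) (simp_all del: upt_Suc)
  have snds: "(\<Prod>i=1..?n - 1. \<tau> (?b i)) = prod_list (map (\<lambda>y. \<tau> (snd y)) (butlast l))"
    unfolding prod_list_butlast_nth[OF assms(3), symmetric]
    by (intro prod.cong) auto
  have lst: "?b ?n = snd (last l)"
    using assms(3) by (simp add: last_conv_nth)
  have moment: "\<omega> (alt_prod ?n a b) = \<omega> (prod_list (map a [1..<Suc ?n])) *
      (\<Prod>i=1..?n - 1. \<tau> (b i)) * \<tau> (b ?n * b 0)"
    if "\<forall>i\<in>{1..?n}. a i \<in> A" "\<forall>i\<in>{0..?n}. b i \<in> B" for a b
    using indep n that unfolding cyclic_monotone_indep_def by blast
  show "\<omega> (word x l) = \<omega> (prod_list (map fst l)) *
      prod_list (map (\<lambda>y. \<tau> (snd y)) (butlast l)) * \<tau> (snd (last l) * x)"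
    using moment[OF a b] unfolding alt_prod_word[of x l] fsts snds lst by simp
qed

definition words :: "'c set" where
  "words = {word x l | x l. x \<in> B \<and> set l \<subseteq> A \<times> B}"

text \<open>Where two words meet, the last letter of the first and the first letter of the second both lie
  in \<open>B\<close> and merge into one.\<close>

lemma words_mult:
  assumes "u \<in> words" "v \<in> words"
  shows "u * v \<in> words"
proof -
  obtain x l where u: "u = word x l" "x \<in> B" "set l \<subseteq> A \<times> B"
    using assms(1) by (auto simp: words_def)
  obtain y m where v: "v = word y m" "y \<in> B" "set m \<subseteq> A \<times> B"
    using assms(2) by (auto simp: words_def)
  show ?thesis
  proof (cases l rule: rev_cases)
    case Nil
    then have "u * v = word (x * y) m"
      by (simp add: u v word_def mult.assoc)
    then show ?thesis using u v mult_B unfolding words_def by blast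
  next
    case (snoc l' ab)
    obtain a b where ab: "ab = (a, b)" by fastforce
    have "u * v = word x (l' @ [(a, b * y)] @ m)"
      by (simp add: u v snoc ab word_def mult.assoc)
    moreover have "set (l' @ [(a, b * y)] @ m) \<subseteq> A \<times> B"
      using u v mult_B by (auto simp: snoc ab)
    ultimately show ?thesis using u(2) unfolding words_def by blast
  qed
qed

lemma B_words: "x \<in> B \<Longrightarrow> x \<in> words"
  unfolding words_def by (intro CollectI exI[of _ x] exI[of _ "[]"]) (simp add: word_def)

lemma one_words: "1 \<in> words"
  by (rule B_words[OF one_B])

lemma A_words: "x \<in> A \<Longrightarrow> x \<in> words"
  unfolding words_def using one_B
  by (intro CollectI exI[of _ 1] exI[of _ "[(x, 1)]"]) (simp add: word_def)

lemma prod_list_words: "set xs \<subseteq> A \<union> B \<Longrightarrow> prod_list xs \<in> words"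
  by (induction xs) (auto simp: one_words intro: words_mult A_words B_words)

text \<open>Membership in \<open>D\<close> is part of the definition because \<open>\<omega>\<close> is arbitrary outside \<open>D\<close>. Words of
  length \<open>0\<close>, which are the elements of \<open>B\<close>, are allowed on both sides; in particular \<open>u = v = 1\<close>.\<close>

definition null_ideal :: "'c set" where
  "null_ideal = {x. \<forall>u\<in>words. \<forall>v\<in>words. u * x * v \<in> D \<and> \<omega> (u * x * v) = 0}"

lemma weight_null: "x \<in> null_ideal \<Longrightarrow> x \<in> D \<and> \<omega> x = 0"
  using one_words unfolding null_ideal_def by fastforce

lemma subspace_null: "cvec.subspace null_ideal"
  unfolding cvec.subspace_def null_ideal_def
  by (auto simp: weight_zero weight_add weight_scale distrib_left distrib_right
      mult_scaleC_left mult_scaleC_right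
      intro: cvec.subspace_0[OF subspace_D] cvec.subspace_add[OF subspace_D]
        cvec.subspace_scale[OF subspace_D])

lemma null_mult_words:
  assumes "x \<in> null_ideal" "u \<in> words" "v \<in> words"
  shows "u * x * v \<in> null_ideal"
proof -
  have "u' * (u * x * v) * v' \<in> D \<and> \<omega> (u' * (u * x * v) * v') = 0"
    if "u' \<in> words" "v' \<in> words" for u' v'
  proof -
    have "(u' * u) * x * (v * v') \<in> D \<and> \<omega> ((u' * u) * x * (v * v')) = 0"
      using assms that words_mult unfolding null_ideal_def by blast
    then show ?thesis by (simp add: mult.assoc)
  qed
  then show ?thesis by (simp add: null_ideal_def)
qed

lemma null_mult_span:
  assumes "x \<in> null_ideal" "u \<in> cvec.span words"
  shows "u * x \<in> null_ideal" "x * u \<in> null_ideal"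
proof -
  have "cvec.subspace {u. u * x \<in> null_ideal}" "cvec.subspace {u. x * u \<in> null_ideal}"
    using subspace_null unfolding cvec.subspace_def
    by (simp_all add: distrib_left distrib_right mult_scaleC_left mult_scaleC_right)
  moreover have "words \<subseteq> {u. u * x \<in> null_ideal}" "words \<subseteq> {u. x * u \<in> null_ideal}"
    using null_mult_words[OF assms(1) _ one_words] null_mult_words[OF assms(1) one_words] by auto
  ultimately show "u * x \<in> null_ideal" "x * u \<in> null_ideal"
    using cvec.span_minimal assms(2) by blast+
qed

text \<open>Replacing \<open>a b a'\<close> by \<open>a a'\<close> inside a word removes the inner letter \<open>b\<close>, hence exactly the
  factor \<open>\<tau> b\<close> of the moment formula: the product of the letters from \<open>A\<close> is the same, and the
  outermost letters from \<open>B\<close>, which enter through \<open>\<tau> (b\<^sub>n b\<^sub>0)\<close>, are not touched.\<close>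

lemma null_cut:
  assumes "a \<in> A" "b \<in> B" "a' \<in> A"
  shows "a * b * a' - \<tau> b *\<^sub>C (a * a') \<in> null_ideal"
proof -
  have "u * (a * b * a' - \<tau> b *\<^sub>C (a * a')) * v \<in> D \<and>
      \<omega> (u * (a * b * a' - \<tau> b *\<^sub>C (a * a')) * v) = 0"
    if uv: "u \<in> words" "v \<in> words" for u v
  proof -
    obtain x l where u: "u = word x l" "x \<in> B" "set l \<subseteq> A \<times> B"
      using uv(1) by (auto simp: words_def)
    obtain y m where v: "v = word y m" "y \<in> B" "set m \<subseteq> A \<times> B"
      using uv(2) by (auto simp: words_def)
    \<comment> \<open>The letter \<open>y\<close> that begins \<open>v\<close> closes the pair of \<open>a'\<close>, respectively of \<open>a a'\<close>.\<close>
    let ?l = "l @ [(a, b), (a', y)] @ m" and ?l' = "l @ [(a * a', y)] @ m"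
    have l: "set ?l \<subseteq> A \<times> B" "set ?l' \<subseteq> A \<times> B"
      using u v assms mult_A by auto
    have ne: "?l \<noteq> []" "?l' \<noteq> []" by auto
    note w = weight_word[OF u(2) l(1) ne(1)] and w' = weight_word[OF u(2) l(2) ne(2)]
    have "\<omega> (word x ?l) = \<tau> b * \<omega> (word x ?l')"
      unfolding w(2) w'(2) by (cases m rule: rev_cases) (simp_all add: butlast_append mult.assoc)
    moreover have eq: "u * (a * b * a' - \<tau> b *\<^sub>C (a * a')) * v = word x ?l + (- \<tau> b) *\<^sub>C word x ?l'"
      by (simp add: u v word_def algebra_simps mult_scaleC_left mult_scaleC_right
          cvec.scale_minus_left)
    moreover have scaled: "(- \<tau> b) *\<^sub>C word x ?l' \<in> D"
      by (rule cvec.subspace_scale[OF subspace_D w'(1)])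
    ultimately show ?thesis
      by (simp only: eq weight_add[OF w(1) scaled] weight_scale[OF w'(1)]
          cvec.subspace_add[OF subspace_D w(1) scaled]) simp
  qed
  then show ?thesis by (simp add: null_ideal_def)
qed

lemma null_centred:
  assumes "a \<in> A" "b \<in> B" "a' \<in> A" "\<tau> b = 0"
  shows "a * b * a' \<in> null_ideal"
  using null_cut[OF assms(1-3)] assms(4) by simp

end

text \<open>Consecutive letters \<open>a\<close> of an alternating monomial are separated by exactly one \<open>b\<close>.\<close>

lemma alternating_two_A:
  assumes "successively (\<lambda>x y. is_A x \<noteq> is_A y) w" "length (filter is_A w) \<ge> 2"
  shows "\<exists>u i j i' v. w = u @ [LetA i, LetB j, LetA i'] @ v"
  using assms
proof (induction w)
  case (Cons x w)
  show ?case
  proof (cases "length (filter is_A w) \<ge> 2")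
    case True
    moreover have "successively (\<lambda>x y. is_A x \<noteq> is_A y) w"
      using Cons.prems(1) by (cases w) simp_all
    ultimately obtain u i j i' v where "w = u @ [LetA i, LetB j, LetA i'] @ v"
      using Cons.IH by blast
    then have "x # w = (x # u) @ [LetA i, LetB j, LetA i'] @ v" by simp
    then show ?thesis by blast
  next
    case False
    then have x: "is_A x" and one: "length (filter is_A w) = 1"
      using Cons.prems(2) by (auto split: if_splits)
    obtain y w' where w: "w = y # w'" using one by (cases w) auto
    have y: "\<not> is_A y" using x Cons.prems(1) by (simp add: w)
    then obtain z w'' where w': "w' = z # w''" using one by (cases w') (auto simp: w)
    have "is_A z" using y Cons.prems(1) by (simp add: w w')
    then show ?thesis using x y
      by (cases x; cases y; cases z) (auto simp: w w' intro!: exI[of _ "[]"])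
  qed
qed simp

section \<open>Block powers\<close>

text \<open>This is the \<open>(s, t)\<close> block of the power with exponent \<open>k + 1\<close> of the block matrix \<open>\<alpha>\<close> with index set
  \<open>{0..q}\<close>. The shift of the exponent avoids the unit, which $M_\infty$ does not have.\<close>

primrec block_power :: "nat \<Rightarrow> (nat \<Rightarrow> nat \<Rightarrow> 'a::ring) \<Rightarrow> nat \<Rightarrow> nat \<Rightarrow> nat \<Rightarrow> 'a" where
  "block_power q \<alpha> 0 s t = \<alpha> s t"
| "block_power q \<alpha> (Suc k) s t = (\<Sum>u=0..q. block_power q \<alpha> k s u * \<alpha> u t)"

lemma star_hom_sum:
  assumes "star_hom f"
  shows "f (\<Sum>i\<in>I. x i) = (\<Sum>i\<in>I. f (x i))"
proof -
  have 0: "f 0 = 0"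
    using assms cvec.scale_zero_left unfolding star_hom_def by metis
  show ?thesis
    by (induction I rule: infinite_finite_induct) (use assms in \<open>auto simp: 0 star_hom_def\<close>)
qed

lemma block_power_hom:
  assumes "star_hom f"
  shows "f (block_power q \<alpha> k s t) = block_power q (\<lambda>s t. f (\<alpha> s t)) k s t"
  by (induction k arbitrary: s t)
    (use assms in \<open>auto simp: star_hom_sum[OF assms] star_hom_def\<close>)

context cyclic_monotone_pair
begin

lemma block_power_A:
  assumes "\<And>s t. \<alpha> s t \<in> A"
  shows "block_power q \<alpha> k s t \<in> A"
  by (induction k arbitrary: s t)
    (auto simp: assms intro!: cvec.subspace_sum[OF subspace_A] mult_A)

text \<open>Modulo the null ideal, \<open>(b\<^sub>s x b\<^sub>t) (b\<^sub>u y b\<^sub>v)\<close> equals \<open>\<tau> (b\<^sub>t b\<^sub>u) b\<^sub>s x y b\<^sub>v\<close>, so the elements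
  \<open>b\<^sub>s x b\<^sub>t\<close> multiply like matrix units with coefficients in \<open>A\<close>.\<close>

lemma power_mod_null:
  assumes \<alpha>: "\<And>s t. \<alpha> s t \<in> A" and b: "\<And>s. s \<le> q \<Longrightarrow> b s \<in> B"
    and orth: "\<And>s t. s \<le> q \<Longrightarrow> t \<le> q \<Longrightarrow> \<tau> (b s * b t) = (if s = t then 1 else 0)"
    and R: "R \<in> null_ideal" "R \<in> cvec.span words"
  defines "S \<equiv> \<lambda>g. \<Sum>s=0..q. \<Sum>t=0..q. b s * g s t * b t"
  shows "(S \<alpha> + R) ^ Suc k - S (block_power q \<alpha> k) \<in> null_ideal"
proof (induction k)
  case 0
  then show ?case using R by (simp add: S_def)
next
  case (Suc k)
  let ?g = "block_power q \<alpha> k" and ?P = "S \<alpha> + R"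
  have g: "?g s t \<in> A" for s t by (rule block_power_A[OF \<alpha>])
  have S_span: "S h \<in> cvec.span words" if "\<And>s t. h s t \<in> A" for h
    unfolding S_def
    by (intro cvec.span_sum cvec.span_base words_mult) (auto intro: that b A_words B_words)
  have "(?P ^ Suc k - S ?g) * ?P \<in> null_ideal"
    by (rule null_mult_span(2)[OF Suc]) (intro cvec.span_add S_span \<alpha> R(2))
  moreover have "S ?g * R \<in> null_ideal"
    by (rule null_mult_span(1)[OF R(1) S_span[OF g]])
  moreover have "S ?g * S \<alpha> - S (block_power q \<alpha> (Suc k)) \<in> null_ideal"
  proof -
    \<comment> \<open>The difference is a sum of elements to which \<open>null_cut\<close> applies, multiplied by letters of \<open>B\<close>.\<close>
    let ?d = "\<lambda>s t u v. b s * (?g s t * (b t * b u) * \<alpha> u v - \<tau> (b t * b u) *\<^sub>C (?g s t * \<alpha> u v)) * b v"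
    have d: "?d s t u v \<in> null_ideal" if "s \<le> q" "t \<le> q" "u \<le> q" "v \<le> q" for s t u v
      by (intro null_mult_words null_cut) (use that g \<alpha> b mult_B B_words in auto)
    have "S ?g * S \<alpha> = (\<Sum>s=0..q. \<Sum>v=0..q. \<Sum>t=0..q. \<Sum>u=0..q.
        b s * ?g s t * b t * (b u * \<alpha> u v * b v))"
    proof -
      have "S ?g * S \<alpha> = (\<Sum>s=0..q. \<Sum>t=0..q. \<Sum>u=0..q. \<Sum>v=0..q.
          b s * ?g s t * b t * (b u * \<alpha> u v * b v))"
        unfolding S_def sum_distrib_right by (simp only: sum_distrib_left)
      also have "\<dots> = (\<Sum>s=0..q. \<Sum>t=0..q. \<Sum>v=0..q. \<Sum>u=0..q.
          b s * ?g s t * b t * (b u * \<alpha> u v * b v))"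
        by (intro sum.cong refl sum.swap)
      also have "\<dots> = (\<Sum>s=0..q. \<Sum>v=0..q. \<Sum>t=0..q. \<Sum>u=0..q.
          b s * ?g s t * b t * (b u * \<alpha> u v * b v))"
        by (intro sum.cong refl sum.swap)
      finally show ?thesis .
    qed
    moreover have "S (block_power q \<alpha> (Suc k)) = (\<Sum>s=0..q. \<Sum>v=0..q. \<Sum>t=0..q. \<Sum>u=0..q.
        b s * (\<tau> (b t * b u) *\<^sub>C (?g s t * \<alpha> u v)) * b v)"
    proof -
      have "(\<Sum>u=0..q. b s * (\<tau> (b t * b u) *\<^sub>C (?g s t * \<alpha> u v)) * b v)
          = b s * (?g s t * \<alpha> t v) * b v" if "t \<in> {0..q}" for s t v
      proof -
        have "(\<Sum>u=0..q. b s * (\<tau> (b t * b u) *\<^sub>C (?g s t * \<alpha> u v)) * b v)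
            = (\<Sum>u=0..q. if t = u then b s * (?g s t * \<alpha> u v) * b v else 0)"
          using that by (intro sum.cong) (auto simp: orth scaleC_one)
        then show ?thesis using that by simp
      qed
      then have "(\<Sum>t=0..q. \<Sum>u=0..q. b s * (\<tau> (b t * b u) *\<^sub>C (?g s t * \<alpha> u v)) * b v)
          = b s * block_power q \<alpha> (Suc k) s v * b v" for s v
        unfolding block_power.simps sum_distrib_left sum_distrib_right
        by (intro sum.cong refl) blast
      then show ?thesis unfolding S_def by simp
    qed
    ultimately have "S ?g * S \<alpha> - S (block_power q \<alpha> (Suc k))
        = (\<Sum>s=0..q. \<Sum>v=0..q. \<Sum>t=0..q. \<Sum>u=0..q. ?d s t u v)"
      by (simp only: sum_subtractf[symmetric] right_diff_distrib left_diff_distrib mult.assoc)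
    then show ?thesis
      by (simp only:) (intro cvec.subspace_sum[OF subspace_null] d, auto)
  qed
  ultimately have "(?P ^ Suc k - S ?g) * ?P + S ?g * R + (S ?g * S \<alpha> - S (block_power q \<alpha> (Suc k)))
      \<in> null_ideal"
    by (intro cvec.subspace_add[OF subspace_null])
  also have "(?P ^ Suc k - S ?g) * ?P + S ?g * R + (S ?g * S \<alpha> - S (block_power q \<alpha> (Suc k)))
      = ?P ^ Suc (Suc k) - S (block_power q \<alpha> (Suc k))"
    unfolding power_Suc2[of ?P "Suc k"] left_diff_distrib distrib_left
    by (simp del: power_Suc block_power.simps)
  finally show ?case .
qed

lemma weight_power:
  assumes \<alpha>: "\<And>s t. \<alpha> s t \<in> A" and b: "\<And>s. s \<le> q \<Longrightarrow> b s \<in> B"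
    and orth: "\<And>s t. s \<le> q \<Longrightarrow> t \<le> q \<Longrightarrow> \<tau> (b s * b t) = (if s = t then 1 else 0)"
    and R: "R \<in> null_ideal" "R \<in> cvec.span words"
    and P: "P = (\<Sum>s=0..q. \<Sum>t=0..q. b s * \<alpha> s t * b t) + R"
  shows "P ^ Suc k \<in> D" and "\<omega> (P ^ Suc k) = (\<Sum>s=0..q. \<omega> (block_power q \<alpha> k s s))"
proof -
  let ?g = "block_power q \<alpha> k"
  let ?S = "\<Sum>s=0..q. \<Sum>t=0..q. b s * ?g s t * b t"
  have w: "b s * ?g s t * b t \<in> D" "\<omega> (b s * ?g s t * b t) = \<omega> (?g s t) * \<tau> (b t * b s)"
    if "s \<in> {0..q}" "t \<in> {0..q}" for s t
    using weight_word[of "b s" "[(?g s t, b t)]"] that b block_power_A[OF \<alpha>]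
    by (simp_all add: word_def mult.assoc)
  have S: "?S \<in> D" by (intro cvec.subspace_sum[OF subspace_D] w)
  have null: "P ^ Suc k - ?S \<in> null_ideal"
    using power_mod_null[OF \<alpha> b orth R] by (simp only: P)
  have eq: "P ^ Suc k = (P ^ Suc k - ?S) + ?S" by simp
  show "P ^ Suc k \<in> D"
    by (subst eq, rule cvec.subspace_add[OF subspace_D _ S]) (use weight_null[OF null] in blast)
  have "\<omega> (P ^ Suc k) = \<omega> ?S"
    by (subst eq, subst weight_add) (use weight_null[OF null] S in auto)
  also have "\<dots> = (\<Sum>s=0..q. \<Sum>t=0..q. \<omega> (b s * ?g s t * b t))"
    by (subst weight_sum) (auto intro!: cvec.subspace_sum[OF subspace_D] w sum.cong weight_sum)
  also have "\<dots> = (\<Sum>s=0..q. \<Sum>t=0..q. if s = t then \<omega> (?g s t) else 0)"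
    by (intro sum.cong refl) (auto simp: w orth)
  also have "\<dots> = (\<Sum>s=0..q. \<omega> (?g s s))" by simp
  finally show "\<omega> (P ^ Suc k) = (\<Sum>s=0..q. \<omega> (?g s s))" .
qed

text \<open>Every \<open>b\<close> between two letters \<open>a\<close> is centred, so the factor \<open>a\<^sub>i b\<^sub>j a\<^sub>i'\<close> is null and the ideal
  property spreads this to the whole monomial.\<close>

lemma alternating_monomial_null:
  assumes a: "\<And>j. j \<in> {1..p} \<Longrightarrow> a j \<in> A" and b: "\<And>j. j \<in> {1..q} \<Longrightarrow> b j \<in> B \<and> \<tau> (b j) = 0"
    and w: "alternating_monomial p q w" "length (filter is_A w) \<ge> 2"
  shows "eval_monomial a b w \<in> null_ideal" "eval_monomial a b w \<in> words"
proof -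
  have letters: "eval_monomial a b v \<in> words" if "set v \<subseteq> set w" for v
  proof -
    have "(case x of LetA i \<Rightarrow> a i | LetB j \<Rightarrow> b j) \<in> A \<union> B" if "x \<in> set w" for x
      using w(1) that a b unfolding alternating_monomial_def by (cases x) auto
    then show ?thesis
      unfolding eval_monomial_def using that by (intro prod_list_words) auto
  qed
  then show "eval_monomial a b w \<in> words" by simp
  obtain u i j i' v where w_eq: "w = u @ [LetA i, LetB j, LetA i'] @ v"
    using alternating_two_A w unfolding alternating_monomial_def by blast
  have ij: "i \<in> {1..p}" "j \<in> {1..q}" "i' \<in> {1..p}"
    using w(1) unfolding alternating_monomial_def w_eq by auto
  have "eval_monomial a b w = eval_monomial a b u * (a i * b j * a i') * eval_monomial a b v"
    by (simp add: eval_monomial_def w_eq mult.assoc)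
  also have "\<dots> \<in> null_ideal"
    by (intro null_mult_words null_centred letters) (use a b ij in \<open>auto simp: w_eq\<close>)
  finally show "eval_monomial a b w \<in> null_ideal" .
qed

end


section \<open>Kronecker products and their traces\<close>

lemma sum_lessThan_mult:
  fixes f :: "nat \<Rightarrow> 'a::comm_monoid_add"
  shows "(\<Sum>x<n * m. f x) = (\<Sum>i<n. \<Sum>k<m. f (i * m + k))"
proof -
  have "(\<Sum>x<n * m. f x) = (\<Sum>i<n. \<Sum>x=i * m..<i * m + m. f x)"
    by (rule sum.nat_group[symmetric])
  moreover have "(\<Sum>x=y..<y + m. f x) = (\<Sum>k<m. f (y + k))" for y
    by (rule sum.reindex_bij_witness[of _ "\<lambda>k. y + k" "\<lambda>x. x - y"]) auto
  ultimately show ?thesis by simp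
qed

lemma mult_add_less: "i < n \<Longrightarrow> k < m \<Longrightarrow> i * m + k < n * m" for i k m n :: nat
proof -
  assume "i < n" "k < m"
  then have "i * m + k < Suc i * m" by simp
  also have "\<dots> \<le> n * m" using \<open>i < n\<close> by (intro mult_right_mono) auto
  finally show ?thesis .
qed

lemma div_mod_less: "r < n * m \<Longrightarrow> r div m < n \<and> r mod m < m" for r m n :: nat
  by (cases "m = 0") (auto simp: less_mult_imp_div_less)

lemma kron_carrier: "X \<in> carrier_mat a b \<Longrightarrow> Y \<in> carrier_mat c d \<Longrightarrow> X \<otimes>\<^sub>K Y \<in> carrier_mat (a * c) (b * d)"
  by (auto simp: kron_def)

lemma kron_index:
  assumes "X \<in> carrier_mat a b" "Y \<in> carrier_mat c d" "i < a" "k < c" "j < b" "l < d"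
  shows "(X \<otimes>\<^sub>K Y) $$ (i * c + k, j * d + l) = X $$ (i, j) * Y $$ (k, l)"
  using assms mult_add_less[of i a k c] mult_add_less[of j b l d] by (simp add: kron_def)

lemma kron_mult:
  assumes X: "X \<in> carrier_mat a b" and Y: "Y \<in> carrier_mat c d"
    and Z: "Z \<in> carrier_mat b e" and V: "V \<in> carrier_mat d f"
  shows "(X \<otimes>\<^sub>K Y) * (Z \<otimes>\<^sub>K V) = (X * Z) \<otimes>\<^sub>K (Y * V)"
proof (rule eq_matI)
  note XY = kron_carrier[OF X Y] and ZV = kron_carrier[OF Z V]
  have P: "X * Z \<in> carrier_mat a e" "Y * V \<in> carrier_mat c f" using X Y Z V by auto
  note PQ = kron_carrier[OF P]
  show "dim_row ((X \<otimes>\<^sub>K Y) * (Z \<otimes>\<^sub>K V)) = dim_row ((X * Z) \<otimes>\<^sub>K (Y * V))"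
    and "dim_col ((X \<otimes>\<^sub>K Y) * (Z \<otimes>\<^sub>K V)) = dim_col ((X * Z) \<otimes>\<^sub>K (Y * V))"
    using XY ZV PQ by auto
  fix r s assume "r < dim_row ((X * Z) \<otimes>\<^sub>K (Y * V))" "s < dim_col ((X * Z) \<otimes>\<^sub>K (Y * V))"
  then have rs: "r < a * c" "s < e * f" using PQ by auto
  define i k j l where "i = r div c" and "k = r mod c" and "j = s div f" and "l = s mod f"
  have ik: "i < a" "k < c" "j < e" "l < f" and r: "r = i * c + k" and s: "s = j * f + l"
    using rs[THEN div_mod_less] by (auto simp: i_def k_def j_def l_def)
  have "((X \<otimes>\<^sub>K Y) * (Z \<otimes>\<^sub>K V)) $$ (r, s)
      = (\<Sum>x<b * d. (X \<otimes>\<^sub>K Y) $$ (r, x) * (Z \<otimes>\<^sub>K V) $$ (x, s))"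
    using XY ZV rs by (simp add: scalar_prod_def lessThan_atLeast0)
  also have "\<dots> = (\<Sum>x<b. \<Sum>y<d. (X $$ (i, x) * Y $$ (k, y)) * (Z $$ (x, j) * V $$ (y, l)))"
    unfolding sum_lessThan_mult r s using X Y Z V ik
    by (intro sum.cong refl arg_cong2[where f = "(*)"] kron_index) auto
  also have "\<dots> = (\<Sum>x<b. \<Sum>y<d. (X $$ (i, x) * Z $$ (x, j)) * (Y $$ (k, y) * V $$ (y, l)))"
    by (intro sum.cong refl) (simp add: mult_ac)
  also have "\<dots> = (\<Sum>x<b. X $$ (i, x) * Z $$ (x, j)) * (\<Sum>y<d. Y $$ (k, y) * V $$ (y, l))"
    by (simp only: sum_product)
  also have "\<dots> = (X * Z) $$ (i, j) * (Y * V) $$ (k, l)"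
    using X Y Z V ik by (simp add: scalar_prod_def lessThan_atLeast0)
  also have "\<dots> = ((X * Z) \<otimes>\<^sub>K (Y * V)) $$ (r, s)"
    unfolding r s by (rule kron_index[OF P ik(1,2,3,4), symmetric])
  finally show "((X \<otimes>\<^sub>K Y) * (Z \<otimes>\<^sub>K V)) $$ (r, s) = ((X * Z) \<otimes>\<^sub>K (Y * V)) $$ (r, s)" .
qed

lemma kron_one: "1\<^sub>m a \<otimes>\<^sub>K 1\<^sub>m b = 1\<^sub>m (a * b)"
proof (rule eq_matI)
  fix i j assume "i < dim_row (1\<^sub>m (a * b) :: complex mat)" "j < dim_col (1\<^sub>m (a * b) :: complex mat)"
  then have ij: "i < a * b" "j < a * b" by auto
  have "i = j \<longleftrightarrow> i div b = j div b \<and> i mod b = j mod b"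
    by (metis div_mult_mod_eq)
  then show "(1\<^sub>m a \<otimes>\<^sub>K 1\<^sub>m b) $$ (i, j) = (1\<^sub>m (a * b) :: complex mat) $$ (i, j)"
    using ij ij[THEN div_mod_less] by (auto simp: kron_def)
qed (simp_all add: kron_def)

lemma kron_list_Nil: "kron_list [] = 1\<^sub>m 1"
  and kron_list_Cons: "kron_list (Y # Ys) = Y \<otimes>\<^sub>K kron_list Ys"
  by (simp_all add: kron_list_def)

lemma kron_list_carrier:
  "set Ys \<subseteq> carrier_mat 2 2 \<Longrightarrow> kron_list Ys \<in> carrier_mat (2 ^ length Ys) (2 ^ length Ys)"
  by (induction Ys) (auto simp: kron_list_Nil kron_list_Cons intro!: kron_carrier)

lemma kron_list_mult:
  assumes "length Ys = length Zs" "set Ys \<subseteq> carrier_mat 2 2" "set Zs \<subseteq> carrier_mat 2 2"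
  shows "kron_list Ys * kron_list Zs = kron_list (map2 (*) Ys Zs)"
  using assms
proof (induction Ys Zs rule: list_induct2)
  case (Cons Y Ys Z Zs)
  have "kron_list (Y # Ys) * kron_list (Z # Zs) = (Y * Z) \<otimes>\<^sub>K (kron_list Ys * kron_list Zs)"
    unfolding kron_list_Cons
    by (rule kron_mult[where a = 2 and b = 2 and e = 2 and c = "2 ^ length Ys" and d = "2 ^ length Ys"
          and f = "2 ^ length Ys"])
      (use Cons.prems Cons.hyps kron_list_carrier[of Ys] kron_list_carrier[of Zs] in auto)
  then show ?case using Cons by (simp add: kron_list_Cons)
qed (simp add: kron_list_Nil)

lemma kron_list_corner:
  "set Ys \<subseteq> carrier_mat 2 2 \<Longrightarrow> kron_list Ys $$ (0, 0) = prod_list (map (\<lambda>Y. Y $$ (0, 0)) Ys)"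
proof (induction Ys)
  case (Cons Y Ys)
  then show ?case
    using kron_index[of Y 2 2 "kron_list Ys" "2 ^ length Ys" "2 ^ length Ys" 0 0 0 0]
      kron_list_carrier[of Ys] by (simp add: kron_list_Cons)
qed (simp add: kron_list_Nil)

lemma J_mat_carrier: "J_mat \<in> carrier_mat 2 2"
  by (intro carrier_matI) (simp_all add: J_mat_def mat_of_rows_list_def)

lemma E11_mat_carrier: "E11_mat \<in> carrier_mat 2 2"
  by (intro carrier_matI) (simp_all add: E11_mat_def mat_of_rows_list_def)

lemma J_mat_corner: "J_mat $$ (0, 0) = 0"
  by (simp add: J_mat_def mat_of_rows_list_def)

lemma J_mat_square: "J_mat * J_mat = 1\<^sub>m 2"
  by (rule eq_matI)
    (auto simp: J_mat_def mat_of_rows_list_def scalar_prod_def less_Suc_eq numeral_2_eq_2)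

lemma E11_power_carrier: "kron_list (replicate q E11_mat) \<in> carrier_mat (2 ^ q) (2 ^ q)"
proof -
  have "set (replicate q E11_mat) \<subseteq> carrier_mat 2 2" using E11_mat_carrier by auto
  from kron_list_carrier[OF this] show ?thesis by simp
qed

lemma E11_power_index:
  assumes "\<kappa> < 2 ^ q" "\<mu> < 2 ^ q"
  shows "kron_list (replicate q E11_mat) $$ (\<kappa>, \<mu>) = (if \<kappa> = 0 \<and> \<mu> = 0 then 1 else 0)"
  using assms
proof (induction q arbitrary: \<kappa> \<mu>)
  case (Suc q)
  let ?M = "2 ^ q :: nat"
  have E: "E11_mat $$ (i, j) = (if i = 0 \<and> j = 0 then 1 else 0)" if "i < 2" "j < 2" for i j
    using that by (auto simp: E11_mat_def mat_of_rows_list_def less_2_cases_iff)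
  have bnd: "\<kappa> div ?M < 2" "\<kappa> mod ?M < ?M" "\<mu> div ?M < 2" "\<mu> mod ?M < ?M"
    using Suc.prems div_mod_less[of \<kappa> 2 ?M] div_mod_less[of \<mu> 2 ?M] by auto
  have zero: "x div ?M = 0 \<and> x mod ?M = 0 \<longleftrightarrow> x = 0" for x
    by (metis div_mult_mod_eq add.right_neutral div_0 mod_0 mult_zero_left)
  have "kron_list (replicate (Suc q) E11_mat) $$ (\<kappa>, \<mu>)
      = E11_mat $$ (\<kappa> div ?M, \<mu> div ?M) * kron_list (replicate q E11_mat) $$ (\<kappa> mod ?M, \<mu> mod ?M)"
    using kron_index[OF E11_mat_carrier E11_power_carrier bnd]
    by (simp only: div_mult_mod_eq replicate_Suc kron_list_Cons)
  also have "\<dots> = (if \<kappa> = 0 \<and> \<mu> = 0 then 1 else 0)"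
    unfolding E[OF bnd(1,3)] Suc.IH[OF bnd(2,4)] zero[of \<kappa>, symmetric] zero[of \<mu>, symmetric]
    by auto
  finally show ?case .
qed (simp add: kron_list_Nil)

text \<open>The identity is the case \<open>i = 0\<close>, since the tensor positions are numbered from \<open>1\<close>.\<close>

lemma B_mat_kron:
  "B_mat q i = kron_list (map (\<lambda>k. if k = i then J_mat else 1\<^sub>m 2) [1..<Suc q])"
proof (cases "i = 0")
  case True
  have "kron_list (replicate q (1\<^sub>m 2)) = 1\<^sub>m (2 ^ q)" for q
    by (induction q) (simp_all add: kron_list_Nil kron_list_Cons kron_one)
  moreover have "map (\<lambda>k. if k = i then J_mat else 1\<^sub>m 2) [1..<Suc q] = replicate q (1\<^sub>m 2)"
    using True by (intro nth_equalityI) (simp_all del: upt_Suc)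
  ultimately show ?thesis using True by (simp add: B_mat_def del: upt_Suc)
qed (simp add: B_mat_def)

lemma B_mat_carrier: "B_mat q i \<in> carrier_mat (2 ^ q) (2 ^ q)"
proof -
  have "set (map (\<lambda>k. if k = i then J_mat else 1\<^sub>m 2) [1..<Suc q]) \<subseteq> carrier_mat 2 2"
    using J_mat_carrier by (auto simp del: upt_Suc)
  from kron_list_carrier[OF this] show ?thesis by (simp add: B_mat_kron del: upt_Suc)
qed

text \<open>The model counterpart of \<open>\<tau> (b\<^sub>s b\<^sub>t) = \<delta>\<^sub>s\<^sub>t\<close>, the state being the corner entry. It is multiplicative
  over tensor factors, and a factor has corner entry \<open>0\<close> precisely if it is a single \<open>J\<close>, that
  is, if the position is one of \<open>s\<close> and \<open>t\<close> but not the other.\<close>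

lemma B_mat_orthonormal:
  assumes "s \<le> q" "t \<le> q"
  shows "(\<Sum>\<kappa><2 ^ q. B_mat q s $$ (0, \<kappa>) * B_mat q t $$ (\<kappa>, 0)) = (if s = t then 1 else 0)"
proof -
  let ?f = "\<lambda>i k. if k = i then J_mat else 1\<^sub>m 2"
  have c: "set (map (?f i) [1..<Suc q]) \<subseteq> carrier_mat 2 2" for i
    using J_mat_carrier by (auto simp del: upt_Suc)
  have corner: "(?f s k * ?f t k) $$ (0, 0) = (if k = s \<longleftrightarrow> k = t then 1 else 0)" for k
    by (simp add: J_mat_corner J_mat_square left_mult_one_mat[OF J_mat_carrier]
        right_mult_one_mat[OF J_mat_carrier] left_mult_one_mat[OF one_carrier_mat]
        del: index_mult_mat(1))
  have "(\<Sum>\<kappa><2 ^ q. B_mat q s $$ (0, \<kappa>) * B_mat q t $$ (\<kappa>, 0)) = (B_mat q s * B_mat q t) $$ (0, 0)"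
    using B_mat_carrier[of q s] B_mat_carrier[of q t]
    by (simp add: scalar_prod_def lessThan_atLeast0)
  also have "B_mat q s * B_mat q t = kron_list (map (\<lambda>k. ?f s k * ?f t k) [1..<Suc q])"
    unfolding B_mat_kron by (subst kron_list_mult[OF _ c c]) (simp_all add: map2_map_map del: upt_Suc)
  also have "\<dots> $$ (0, 0) = prod_list (map (\<lambda>k. if k = s \<longleftrightarrow> k = t then 1 else 0) [1..<Suc q])"
    by (subst kron_list_corner)
      (use J_mat_carrier in \<open>auto simp: corner o_def simp del: upt_Suc\<close>)
  also have "\<dots> = (\<Prod>k=1..q. if k = s \<longleftrightarrow> k = t then 1 else 0)"
    by (subst prod.distinct_set_conv_list[symmetric]) (auto intro!: prod.cong)
  also have "\<dots> = (if s = t then 1 else 0)"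
  proof (cases "s = t")
    case False
    \<comment> \<open>The larger of two distinct indices is a tensor position, even if the smaller one is \<open>0\<close>.\<close>
    then have "max s t \<in> {1..q}" "\<not> (max s t = s \<longleftrightarrow> max s t = t)" using assms by auto
    then show ?thesis using False by (subst prod_zero) auto
  qed simp
  finally show ?thesis .
qed

lemma mtrace_unit_mat: "i < n \<Longrightarrow> j < n \<Longrightarrow> mtrace (unit_mat n i j) = (if i = j then 1 else 0)"
  by (auto simp: mtrace_def unit_mat_def if_distrib cong: if_cong)

lemma tensor_functional_trace:
  assumes "\<And>i j. i < n \<Longrightarrow> j < n \<Longrightarrow> \<phi> (unit_mat n i j) = (if i = j then 1 else 0)"
    and "\<And>k l. k < m \<Longrightarrow> l < m \<Longrightarrow> \<psi> (unit_mat m k l) = (if k = l then 1 else 0)"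
  shows "tensor_functional n \<phi> m \<psi> Z = (\<Sum>i<n. \<Sum>k<m. Z $$ (i * m + k, i * m + k))"
proof -
  have "tensor_functional n \<phi> m \<psi> Z = (\<Sum>i<n. \<Sum>j<n. if i = j then
      (\<Sum>k<m. \<Sum>l<m. if k = l then Z $$ (i * m + k, j * m + l) else 0) else 0)"
    unfolding tensor_functional_def
    by (intro sum.cong refl)
      (auto simp: assms if_distrib[of "\<lambda>x. _ * x"] intro!: sum.cong sum.neutral cong: if_cong)
  then show ?thesis by simp
qed

lemma Tr2_power_trace: "Tr2_power q Z = (\<Sum>\<kappa><2 ^ q. Z $$ (\<kappa>, \<kappa>))"
proof (induction q arbitrary: Z)
  case (Suc q)
  have "Tr2_power q (unit_mat (2 ^ q) k l) = (if k = l then 1 else 0)" if "k < 2 ^ q" "l < 2 ^ q" for k l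
    using mtrace_unit_mat[OF that] by (simp add: Suc.IH mtrace_def unit_mat_def)
  then show ?case
    using sum_lessThan_mult[of "\<lambda>x. Z $$ (x, x)" 2 "2 ^ q"]
    by (simp add: tensor_functional_trace[OF mtrace_unit_mat])
qed simp

lemma tensor_trace:
  "tensor_functional n mtrace (2 ^ q) (Tr2_power q) Z
    = (\<Sum>i<n. \<Sum>\<kappa><2 ^ q. Z $$ (i * 2 ^ q + \<kappa>, i * 2 ^ q + \<kappa>))"
proof (rule tensor_functional_trace[OF mtrace_unit_mat])
  show "Tr2_power q (unit_mat (2 ^ q) k l) = (if k = l then 1 else 0)" if "k < 2 ^ q" "l < 2 ^ q" for k l
    using mtrace_unit_mat[OF that] by (simp add: Tr2_power_trace mtrace_def unit_mat_def)
qed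

section \<open>Powers of the tensor model\<close>

lemma mat_sum_carrier: "mat_sum n f I \<in> carrier_mat n n"
  by (simp add: mat_sum_def)

lemma mat_sum_index: "i < n \<Longrightarrow> j < n \<Longrightarrow> mat_sum n f I $$ (i, j) = (\<Sum>x\<in>I. f x $$ (i, j))"
  by (simp add: mat_sum_def)

lemma of_mat_sum:
  assumes "\<And>i. i \<in> I \<Longrightarrow> f i \<in> carrier_mat n n"
  shows "of_mat (mat_sum n f I) = (\<Sum>i\<in>I. of_mat (f i))"
  using assms
proof (induction I rule: infinite_finite_induct)
  case (insert i I)
  have "mat_sum n f (insert i I) = f i + mat_sum n f I"
    by (rule eq_matI) (use insert in \<open>auto simp: mat_sum_def\<close>)
  then have "of_mat (mat_sum n f (insert i I)) = of_mat (f i) + of_mat (mat_sum n f I)"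
    using of_mat_ops(1)[of "f i" n "mat_sum n f I", OF _ mat_sum_carrier] insert.prems by simp
  then show ?case using insert by simp
next
  case (infinite I)
  then have "mat_sum n f I = 0\<^sub>m n n" by (intro eq_matI) (auto simp: mat_sum_def)
  then show ?case using infinite zero_of_mat[of n] by simp
next
  case empty
  have "mat_sum n f {} = 0\<^sub>m n n" by (intro eq_matI) (auto simp: mat_sum_def)
  then show ?case using zero_of_mat[of n] by simp
qed

text \<open>The matrix \<open>\<Sum>\<^sub>j \<lambda>\<^sub>s\<^sub>t\<^sub>j a\<^sub>j\<close> between \<open>b\<^sub>s\<close> and \<open>b\<^sub>t\<close> in the linear part of \<open>P\<close>.\<close>

definition coeff_block ::
  "nat \<Rightarrow> nat \<Rightarrow> (nat \<Rightarrow> nat \<Rightarrow> nat \<Rightarrow> complex) \<Rightarrow> (nat \<Rightarrow> complex mat) \<Rightarrow> nat \<Rightarrow> nat \<Rightarrow> complex mat" where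
  "coeff_block n p c X s t = mat_sum n (\<lambda>j. c s t j \<cdot>\<^sub>m X j) {1..p}"

lemma coeff_block_carrier: "coeff_block n p c X s t \<in> carrier_mat n n"
  by (simp add: coeff_block_def mat_sum_carrier)

text \<open>By the mixed product rule the matrix is \<open>Y \<otimes> B\<^sub>s E B\<^sub>t\<close> with \<open>E\<close> the unit matrix in the corner, and
  \<open>B\<^sub>s E B\<^sub>t\<close> is a column of \<open>B\<^sub>s\<close> times a row of \<open>B\<^sub>t\<close>.\<close>

lemma sandwich_index:
  assumes Y: "Y \<in> carrier_mat n n" and "i < n" "j < n" "\<kappa> < 2 ^ q" "\<mu> < 2 ^ q"
  shows "(b_tilde n q s * phi_mat q Y * b_tilde n q t) $$ (i * 2 ^ q + \<kappa>, j * 2 ^ q + \<mu>)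
    = B_mat q s $$ (\<kappa>, 0) * Y $$ (i, j) * B_mat q t $$ (0, \<mu>)"
proof -
  let ?M = "2 ^ q :: nat" and ?E = "kron_list (replicate q E11_mat)"
  note B = B_mat_carrier[of q]
  have E: "?E \<in> carrier_mat ?M ?M"
    by (rule E11_power_carrier)
  have BE: "B_mat q s * ?E \<in> carrier_mat ?M ?M" by (rule mult_carrier_mat[OF B E])
  have entry_BE: "(B_mat q s * ?E) $$ (\<kappa>, x) = (if x = 0 then B_mat q s $$ (\<kappa>, 0) else 0)" if "x < ?M" for x
  proof -
    have "(B_mat q s * ?E) $$ (\<kappa>, x) = (\<Sum>y<?M. B_mat q s $$ (\<kappa>, y) * ?E $$ (y, x))"
      using that assms carrier_matD[OF B[of s]] carrier_matD[OF E] by (simp add: scalar_prod_def lessThan_atLeast0)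
    also have "\<dots> = (\<Sum>y<?M. if y = 0 then (if x = 0 then B_mat q s $$ (\<kappa>, 0) else 0) else 0)"
      using that by (intro sum.cong refl) (auto simp: E11_power_index)
    finally show ?thesis by simp
  qed
  have "(B_mat q s * ?E * B_mat q t) $$ (\<kappa>, \<mu>) = (\<Sum>x<?M. (B_mat q s * ?E) $$ (\<kappa>, x) * B_mat q t $$ (x, \<mu>))"
    using assms carrier_matD[OF B[of t]] carrier_matD[OF BE]
    by (simp add: scalar_prod_def lessThan_atLeast0 del: index_mult_mat(1)) (subst index_mult_mat(1), auto simp: scalar_prod_def)
  also have "\<dots> = (\<Sum>x<?M. if x = 0 then B_mat q s $$ (\<kappa>, 0) * B_mat q t $$ (0, \<mu>) else 0)"
    by (intro sum.cong refl) (auto simp: entry_BE)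
  also have "\<dots> = B_mat q s $$ (\<kappa>, 0) * B_mat q t $$ (0, \<mu>)" by simp
  finally have BEB: "(B_mat q s * ?E * B_mat q t) $$ (\<kappa>, \<mu>) = B_mat q s $$ (\<kappa>, 0) * B_mat q t $$ (0, \<mu>)" .
  have "b_tilde n q s * phi_mat q Y = Y \<otimes>\<^sub>K (B_mat q s * ?E)"
    using kron_mult[OF one_carrier_mat B Y E] Y by (simp add: b_tilde_def phi_mat_def)
  then have "b_tilde n q s * phi_mat q Y * b_tilde n q t = Y \<otimes>\<^sub>K (B_mat q s * ?E * B_mat q t)"
    using kron_mult[OF Y BE one_carrier_mat B] Y by (simp add: b_tilde_def)
  then show ?thesis
    using kron_index[OF Y mult_carrier_mat[OF BE B] assms(2,4,3,5)] BEB by simp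
qed

lemma P_tilde_carrier: "P_tilde n p q c X \<in> carrier_mat (n * 2 ^ q) (n * 2 ^ q)"
  by (simp add: P_tilde_def mat_sum_carrier)

lemma P_tilde_index:
  assumes X: "\<forall>j\<in>{1..p}. X j \<in> carrier_mat n n"
    and ij: "i < n" "j < n" "\<kappa> < 2 ^ q" "\<mu> < 2 ^ q"
  shows "P_tilde n p q c X $$ (i * 2 ^ q + \<kappa>, j * 2 ^ q + \<mu>)
    = (\<Sum>s=0..q. \<Sum>t=0..q. B_mat q s $$ (\<kappa>, 0) * coeff_block n p c X s t $$ (i, j) * B_mat q t $$ (0, \<mu>))"
proof -
  let ?M = "2 ^ q :: nat"
  have summand: "(c s t l \<cdot>\<^sub>m (b_tilde n q s * phi_mat q (X l) * b_tilde n q t)) $$ (i * ?M + \<kappa>, j * ?M + \<mu>)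
      = B_mat q s $$ (\<kappa>, 0) * (c s t l \<cdot>\<^sub>m X l) $$ (i, j) * B_mat q t $$ (0, \<mu>)"
    if "l \<in> {1..p}" for s t l
  proof -
    have "b_tilde n q s * phi_mat q (X l) * b_tilde n q t \<in> carrier_mat (n * ?M) (n * ?M)"
      unfolding b_tilde_def phi_mat_def
      by (rule mult_carrier_mat[OF mult_carrier_mat])
        (rule kron_carrier one_carrier_mat B_mat_carrier E11_power_carrier bspec[OF X that])+
    from carrier_matD[OF this] show ?thesis
      using sandwich_index[OF bspec[OF X that] ij, of s t] carrier_matD[OF bspec[OF X that]] ij
        mult_add_less[OF ij(1,3)] mult_add_less[OF ij(2,4)]
      by (simp add: mult_ac del: index_mult_mat)
  qed
  have "P_tilde n p q c X $$ (i * ?M + \<kappa>, j * ?M + \<mu>)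
      = (\<Sum>(s, t, l)\<in>{0..q} \<times> {0..q} \<times> {1..p}.
          (c s t l \<cdot>\<^sub>m (b_tilde n q s * phi_mat q (X l) * b_tilde n q t)) $$ (i * ?M + \<kappa>, j * ?M + \<mu>))"
    unfolding P_tilde_def using ij mult_add_less
    by (subst mat_sum_index) (auto simp: case_prod_beta)
  also have "\<dots> = (\<Sum>s=0..q. \<Sum>t=0..q. \<Sum>l=1..p.
      B_mat q s $$ (\<kappa>, 0) * (c s t l \<cdot>\<^sub>m X l) $$ (i, j) * B_mat q t $$ (0, \<mu>))"
    unfolding sum.cartesian_product[symmetric]
    by (intro sum.cong refl summand)
  also have "\<dots> = (\<Sum>s=0..q. \<Sum>t=0..q.
      B_mat q s $$ (\<kappa>, 0) * coeff_block n p c X s t $$ (i, j) * B_mat q t $$ (0, \<mu>))"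
    using ij by (simp add: coeff_block_def mat_sum_index sum_distrib_left sum_distrib_right)
  finally show ?thesis .
qed

lemma sum_rotate:
  "(\<Sum>x\<in>X. \<Sum>y\<in>Y. \<Sum>z\<in>Z. f x y z) = (\<Sum>z\<in>Z. \<Sum>x\<in>X. \<Sum>y\<in>Y. f x y z)"
proof -
  have "(\<Sum>x\<in>X. \<Sum>y\<in>Y. \<Sum>z\<in>Z. f x y z) = (\<Sum>x\<in>X. \<Sum>z\<in>Z. \<Sum>y\<in>Y. f x y z)"
    by (intro sum.cong refl sum.swap)
  also have "\<dots> = (\<Sum>z\<in>Z. \<Sum>x\<in>X. \<Sum>y\<in>Y. f x y z)"
    by (rule sum.swap)
  finally show ?thesis .
qed

text \<open>Summation over the inner index of the second tensor factor contracts the two block indices that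
  meet there.\<close>

lemma sum_biorthogonal:
  fixes x y :: "nat \<Rightarrow> complex"
  shows "(\<Sum>\<nu><2 ^ q. (\<Sum>t=0..q. x t * B_mat q t $$ (0, \<nu>)) * (\<Sum>u=0..q. B_mat q u $$ (\<nu>, 0) * y u))
    = (\<Sum>t=0..q. x t * y t)"
proof -
  have "(\<Sum>\<nu><2 ^ q. (\<Sum>t=0..q. x t * B_mat q t $$ (0, \<nu>)) * (\<Sum>u=0..q. B_mat q u $$ (\<nu>, 0) * y u))
      = (\<Sum>\<nu><2 ^ q. \<Sum>t=0..q. \<Sum>u=0..q. x t * y u * (B_mat q t $$ (0, \<nu>) * B_mat q u $$ (\<nu>, 0)))"
    unfolding sum_product by (intro sum.cong refl) (simp add: mult_ac)
  also have "\<dots> = (\<Sum>t=0..q. \<Sum>u=0..q. \<Sum>\<nu><2 ^ q.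
      x t * y u * (B_mat q t $$ (0, \<nu>) * B_mat q u $$ (\<nu>, 0)))"
    by (rule sum_rotate[symmetric])
  also have "\<dots> = (\<Sum>t=0..q. \<Sum>u=0..q. if t = u then x t * y u else 0)"
    by (intro sum.cong refl) (simp add: sum_distrib_left[symmetric] B_mat_orthonormal)
  finally show ?thesis by simp
qed

text \<open>The counterpart of \<open>power_mod_null\<close>, now an exact identity. The matrices \<open>G s t\<close> represent the
  block powers, formed in the limit algebra, at stage \<open>n\<close>, where their entries can be compared
  with those of the model.\<close>

lemma P_tilde_power_blocks:
  assumes X: "\<forall>j\<in>{1..p}. X j \<in> carrier_mat n n"
  shows "\<exists>G. (\<forall>s t. G s t \<in> carrier_mat n n \<and>
        block_power q (\<lambda>s t. of_mat (coeff_block n p c X s t)) k s t = of_mat (G s t)) \<and>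
      (\<forall>i<n. \<forall>j<n. \<forall>\<kappa><2 ^ q. \<forall>\<mu><2 ^ q.
        (P_tilde n p q c X ^\<^sub>m Suc k) $$ (i * 2 ^ q + \<kappa>, j * 2 ^ q + \<mu>)
        = (\<Sum>s=0..q. \<Sum>t=0..q. B_mat q s $$ (\<kappa>, 0) * G s t $$ (i, j) * B_mat q t $$ (0, \<mu>)))"
proof (induction k)
  case 0
  have "P_tilde n p q c X ^\<^sub>m Suc 0 = P_tilde n p q c X"
    using P_tilde_carrier[of n p q c X] by simp
  then show ?case
    using P_tilde_index[OF X] coeff_block_carrier
    by (intro exI[of _ "coeff_block n p c X"]) (simp del: pow_mat.simps)
next
  case (Suc k)
  let ?M = "2 ^ q :: nat" and ?P = "P_tilde n p q c X" and ?C = "coeff_block n p c X"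
  let ?B = "B_mat q"
  obtain G where G: "\<And>s t. G s t \<in> carrier_mat n n"
    and G_block: "\<And>s t. block_power q (\<lambda>s t. of_mat (?C s t)) k s t = of_mat (G s t)"
    and G_index: "\<And>i j \<kappa> \<mu>. i < n \<Longrightarrow> j < n \<Longrightarrow> \<kappa> < ?M \<Longrightarrow> \<mu> < ?M \<Longrightarrow>
      (?P ^\<^sub>m Suc k) $$ (i * ?M + \<kappa>, j * ?M + \<mu>)
        = (\<Sum>s=0..q. \<Sum>t=0..q. ?B s $$ (\<kappa>, 0) * G s t $$ (i, j) * ?B t $$ (0, \<mu>))"
    using Suc by blast
  define H where "H s v = mat_sum n (\<lambda>t. G s t * ?C t v) {0..q}" for s v
  have H: "H s v \<in> carrier_mat n n" for s v by (simp add: H_def mat_sum_carrier)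
  have "block_power q (\<lambda>s t. of_mat (?C s t)) (Suc k) s v = of_mat (H s v)" for s v
    unfolding H_def
    by (subst of_mat_sum[OF mult_carrier_mat[OF G coeff_block_carrier]])
      (simp add: G_block of_mat_ops(3)[OF G coeff_block_carrier])
  moreover have "(?P ^\<^sub>m Suc (Suc k)) $$ (i * ?M + \<kappa>, j * ?M + \<mu>)
      = (\<Sum>s=0..q. \<Sum>v=0..q. ?B s $$ (\<kappa>, 0) * H s v $$ (i, j) * ?B v $$ (0, \<mu>))"
    if ij: "i < n" "j < n" "\<kappa> < ?M" "\<mu> < ?M" for i j \<kappa> \<mu>
  proof -
    have Pk: "?P ^\<^sub>m Suc k \<in> carrier_mat (n * ?M) (n * ?M)"
      by (rule pow_carrier_mat[OF P_tilde_carrier])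
    have "(?P ^\<^sub>m Suc (Suc k)) $$ (i * ?M + \<kappa>, j * ?M + \<mu>)
        = (\<Sum>x<n * ?M. (?P ^\<^sub>m Suc k) $$ (i * ?M + \<kappa>, x) * ?P $$ (x, j * ?M + \<mu>))"
      unfolding pow_mat.simps(2)[of ?P "Suc k"]
      using carrier_matD[OF Pk] carrier_matD[OF P_tilde_carrier[of n p q c X]] mult_add_less ij
      by (simp add: scalar_prod_def lessThan_atLeast0 del: pow_mat.simps)
    also have "\<dots> = (\<Sum>l<n. \<Sum>\<nu><?M.
        (\<Sum>t=0..q. (\<Sum>s=0..q. ?B s $$ (\<kappa>, 0) * G s t $$ (i, l)) * ?B t $$ (0, \<nu>)) *
        (\<Sum>u=0..q. ?B u $$ (\<nu>, 0) * (\<Sum>v=0..q. ?C u v $$ (l, j) * ?B v $$ (0, \<mu>))))"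
    proof -
      have "(?P ^\<^sub>m Suc k) $$ (i * ?M + \<kappa>, l * ?M + \<nu>)
          = (\<Sum>t=0..q. (\<Sum>s=0..q. ?B s $$ (\<kappa>, 0) * G s t $$ (i, l)) * ?B t $$ (0, \<nu>))"
        if "l < n" "\<nu> < ?M" for l \<nu>
        unfolding G_index[OF ij(1) that(1) ij(3) that(2)] sum_distrib_right by (rule sum.swap)
      moreover have "?P $$ (l * ?M + \<nu>, j * ?M + \<mu>)
          = (\<Sum>u=0..q. ?B u $$ (\<nu>, 0) * (\<Sum>v=0..q. ?C u v $$ (l, j) * ?B v $$ (0, \<mu>)))"
        if "l < n" "\<nu> < ?M" for l \<nu>
        using P_tilde_index[OF X that(1) ij(2) that(2) ij(4)] by (simp add: sum_distrib_left mult.assoc)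
      ultimately show ?thesis
        unfolding sum_lessThan_mult by (intro sum.cong refl arg_cong2[where f = "(*)"]) auto
    qed
    also have "\<dots> = (\<Sum>l<n. \<Sum>t=0..q. (\<Sum>s=0..q. ?B s $$ (\<kappa>, 0) * G s t $$ (i, l)) *
        (\<Sum>v=0..q. ?C t v $$ (l, j) * ?B v $$ (0, \<mu>)))"
      by (intro sum.cong refl sum_biorthogonal)
    also have "\<dots> = (\<Sum>l<n. \<Sum>t=0..q. \<Sum>s=0..q. \<Sum>v=0..q.
        ?B s $$ (\<kappa>, 0) * (G s t $$ (i, l) * ?C t v $$ (l, j)) * ?B v $$ (0, \<mu>))"
      by (simp only: sum_product mult.assoc)
    also have "\<dots> = (\<Sum>s=0..q. \<Sum>v=0..q. \<Sum>l<n. \<Sum>t=0..q.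
        ?B s $$ (\<kappa>, 0) * (G s t $$ (i, l) * ?C t v $$ (l, j)) * ?B v $$ (0, \<mu>))"
      by (subst sum_rotate) (intro sum.cong refl sum_rotate)
    also have "\<dots> = (\<Sum>s=0..q. \<Sum>v=0..q. ?B s $$ (\<kappa>, 0) * H s v $$ (i, j) * ?B v $$ (0, \<mu>))"
    proof (intro sum.cong refl)
      fix s v
      have "(G s t * ?C t v) $$ (i, j) = (\<Sum>l<n. G s t $$ (i, l) * ?C t v $$ (l, j))" for t
        using carrier_matD[OF G[of s t]] carrier_matD[OF coeff_block_carrier[of n p c X t v]] ij
        by (simp add: scalar_prod_def lessThan_atLeast0)
      then have "H s v $$ (i, j) = (\<Sum>l<n. \<Sum>t=0..q. G s t $$ (i, l) * ?C t v $$ (l, j))"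
        using ij by (simp add: H_def mat_sum_index sum.swap[of _ "{..<n}"])
      then show "(\<Sum>l<n. \<Sum>t=0..q.
          ?B s $$ (\<kappa>, 0) * (G s t $$ (i, l) * ?C t v $$ (l, j)) * ?B v $$ (0, \<mu>))
        = ?B s $$ (\<kappa>, 0) * H s v $$ (i, j) * ?B v $$ (0, \<mu>)"
        by (simp only: sum_distrib_left sum_distrib_right)
    qed
    finally show ?thesis .
  qed
  ultimately show ?case using H by blast
qed

lemma trace_P_tilde_power:
  assumes X: "\<forall>j\<in>{1..p}. X j \<in> carrier_mat n n"
  shows "tensor_functional n mtrace (2 ^ q) (Tr2_power q) (P_tilde n p q c X ^\<^sub>m Suc k)
    = (\<Sum>s=0..q. Tr_inf (block_power q (\<lambda>s t. of_mat (coeff_block n p c X s t)) k s s))"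
proof -
  let ?B = "B_mat q" and ?M = "2 ^ q :: nat"
  obtain G where G: "\<And>s t. G s t \<in> carrier_mat n n"
    and G_block: "\<And>s t. block_power q (\<lambda>s t. of_mat (coeff_block n p c X s t)) k s t = of_mat (G s t)"
    and G_index: "\<And>i j \<kappa> \<mu>. i < n \<Longrightarrow> j < n \<Longrightarrow> \<kappa> < ?M \<Longrightarrow> \<mu> < ?M \<Longrightarrow>
      (P_tilde n p q c X ^\<^sub>m Suc k) $$ (i * ?M + \<kappa>, j * ?M + \<mu>)
        = (\<Sum>s=0..q. \<Sum>t=0..q. ?B s $$ (\<kappa>, 0) * G s t $$ (i, j) * ?B t $$ (0, \<mu>))"
    using P_tilde_power_blocks[OF X, where q = q and c = c and k = k] by blast
  have "tensor_functional n mtrace ?M (Tr2_power q) (P_tilde n p q c X ^\<^sub>m Suc k)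
      = (\<Sum>i<n. \<Sum>\<kappa><?M. \<Sum>s=0..q. \<Sum>t=0..q. ?B s $$ (\<kappa>, 0) * G s t $$ (i, i) * ?B t $$ (0, \<kappa>))"
    unfolding tensor_trace by (intro sum.cong refl) (simp add: G_index del: pow_mat.simps)
  also have "\<dots> = (\<Sum>i<n. \<Sum>s=0..q. \<Sum>t=0..q. \<Sum>\<kappa><?M. G s t $$ (i, i) * (?B t $$ (0, \<kappa>) * ?B s $$ (\<kappa>, 0)))"
    by (rule sum.cong[OF refl], rule trans[OF sum_rotate[symmetric]]) (simp add: mult_ac)
  also have "\<dots> = (\<Sum>i<n. \<Sum>s=0..q. \<Sum>t=0..q. if s = t then G s t $$ (i, i) else 0)"
    by (intro sum.cong refl) (auto simp: sum_distrib_left[symmetric] B_mat_orthonormal)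
  also have "\<dots> = (\<Sum>s=0..q. \<Sum>i<n. G s s $$ (i, i))"
    by (simp add: sum.swap[of _ "{..<n}"])
  also have "\<dots> = (\<Sum>s=0..q. Tr_inf (block_power q (\<lambda>s t. of_mat (coeff_block n p c X s t)) k s s))"
    using carrier_matD[OF G] by (simp add: G_block Tr_inf_of_mat square_def mtrace_def)
  finally show ?thesis .
qed

section \<open>The moments of the tensor model\<close>

theorem theorem3p2:
  fixes \<tau> \<omega> :: "'c::unital_star_algebra \<Rightarrow> complex"
    and D A B :: "'c set"
    and \<iota> :: "mat_inf \<Rightarrow> 'c"
    and p q n k :: nat
    and a b :: "nat \<Rightarrow> 'c"
    and X :: "nat \<Rightarrow> complex mat"
    and c :: "nat \<Rightarrow> nat \<Rightarrow> nat \<Rightarrow> complex"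
    and W :: "letter list set"
    and r :: "letter list \<Rightarrow> complex"
    and P R :: 'c
  assumes "nc_probability_space \<tau>"
    and "tracial_weight D \<omega>"
    and "star_subalgebra A"
    and "star_subalgebra B"
    and "1 \<in> B"
    and "star_hom \<iota>" and "inj \<iota>" and "range \<iota> = A"
    and "\<And>x. \<omega> (\<iota> x) = Tr_inf x"
    and "cyclic_monotone_indep A B \<tau> D \<omega>"
    and "\<And>j. j \<in> {1..p} \<Longrightarrow> a j \<in> A \<and> star (a j) = a j"
    and "\<And>i. i \<in> {0..q} \<Longrightarrow> b i \<in> B \<and> star (b i) = b i"
    and "b 0 = 1"
    and "\<And>i. i \<in> {1..q} \<Longrightarrow> \<tau> (b i) = 0"
    and "\<And>i j. i \<in> {0..q} \<Longrightarrow> j \<in> {0..q} \<Longrightarrow> \<tau> (b i * b j) = (if i = j then 1 else 0)"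
    and "finite W"
    and "\<And>w. w \<in> W \<Longrightarrow> alternating_monomial p q w \<and> length (filter is_A w) \<ge> 2"
    and "R = (\<Sum>w\<in>W. r w *\<^sub>C eval_monomial a b w)"
    and "P = (\<Sum>i1=0..q. \<Sum>i2=0..q. \<Sum>j=1..p. c i1 i2 j *\<^sub>C (b i1 * a j * b i2)) + R"
    and "\<And>j. j \<in> {1..p} \<Longrightarrow> X j \<in> carrier_mat n n \<and> a j = \<iota> (of_mat (X j))"
    and "k \<ge> 1"
  shows "P ^ k \<in> D \<and>
    \<omega> (P ^ k) = tensor_functional n mtrace (2 ^ q) (Tr2_power q) (P_tilde n p q c X ^\<^sub>m k)"
proof -
  interpret cyclic_monotone_pair \<tau> \<omega> D A B
    by unfold_locales (fact assms)+
  obtain k' where k: "k = Suc k'" using \<open>k \<ge> 1\<close> by (cases k) auto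
  \<comment> \<open>The block matrix that governs the powers on both sides.\<close>
  let ?x = "\<lambda>s t. of_mat (coeff_block n p c X s t)"
  have X: "\<forall>j\<in>{1..p}. X j \<in> carrier_mat n n" using assms(20) by blast
  have a: "a j \<in> A" if "j \<in> {1..p}" for j using assms(11)[OF that] by blast
  have b: "b s \<in> B" if "s \<le> q" for s using assms(12)[of s] that by simp
  have alpha: "\<iota> (?x s t) \<in> A" for s t using assms(8) by blast
  have alpha_eq: "\<iota> (?x s t) = (\<Sum>j=1..p. c s t j *\<^sub>C a j)" for s t
  proof -
    have "?x s t = (\<Sum>j=1..p. of_mat (c s t j \<cdot>\<^sub>m X j))"
      unfolding coeff_block_def using X by (intro of_mat_sum) auto
    also have "\<dots> = (\<Sum>j=1..p. c s t j *\<^sub>C of_mat (X j))"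
      using X by (intro sum.cong refl of_mat_unary(1)[symmetric]) blast
    finally have "\<iota> (?x s t) = (\<Sum>j=1..p. \<iota> (c s t j *\<^sub>C of_mat (X j)))"
      by (simp only: star_hom_sum[OF assms(6)])
    also have "\<dots> = (\<Sum>j=1..p. c s t j *\<^sub>C a j)"
      using assms(6,20) by (intro sum.cong refl) (simp add: star_hom_def)
    finally show ?thesis .
  qed
  have P: "P = (\<Sum>s=0..q. \<Sum>t=0..q. b s * \<iota> (?x s t) * b t) + R"
    unfolding assms(19) alpha_eq
    by (simp only: sum_distrib_left sum_distrib_right mult_scaleC_left mult_scaleC_right)
  have letters: "b j \<in> B \<and> \<tau> (b j) = 0" if "j \<in> {1..q}" for j
    using that b assms(14) by auto
  have monomial: "eval_monomial a b w \<in> null_ideal" "eval_monomial a b w \<in> words" if "w \<in> W" for w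
    using assms(17)[OF that] by (auto intro: alternating_monomial_null[OF a letters])
  have R: "R \<in> null_ideal" "R \<in> cvec.span words"
    unfolding assms(18)
    by (rule cvec.subspace_sum[OF subspace_null], rule cvec.subspace_scale[OF subspace_null],
        erule monomial(1))
      (rule cvec.span_sum, rule cvec.span_scale, rule cvec.span_base, erule monomial(2))
  have orth: "\<tau> (b s * b t) = (if s = t then 1 else 0)" if "s \<le> q" "t \<le> q" for s t
    using assms(15) that by simp
  have main: "P ^ Suc k' \<in> D"
    "\<omega> (P ^ Suc k') = (\<Sum>s=0..q. \<omega> (block_power q (\<lambda>s t. \<iota> (?x s t)) k' s s))"
    using weight_power[where \<alpha> = "\<lambda>s t. \<iota> (?x s t)" and b = b and q = q and R = R and P = P and k = k',
        OF alpha b orth R P] by simp_all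
  have "\<omega> (P ^ Suc k') = (\<Sum>s=0..q. Tr_inf (block_power q ?x k' s s))"
    unfolding main(2) by (simp only: block_power_hom[OF assms(6), symmetric] assms(9))
  also have "\<dots> = tensor_functional n mtrace (2 ^ q) (Tr2_power q) (P_tilde n p q c X ^\<^sub>m Suc k')"
    by (rule trace_P_tilde_power[OF X, symmetric])
  finally show ?thesis using main(1) unfolding k by blast
qed

end
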